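(* Let $S\subseteq\mathbb{N}^p$ be a simplicial strong affine semigroup with $E=\operatorname{Mult}(S)=\{e_1,\dots,e_t\}$ and $A=\operatorname{msg}(S)\setminus E=\{a_1,\dots,a_r\}$, such that $\sharp E=p$ (that is, $t=p$) and $A$ is non-empty. Then the set of $S$-degrees of the indispensable monomials of $I_S$ is $$\{a+a'\mid a,a'\in A,\ a\neq a'\}\cup\{2a\mid2a\in2A\setminus\operatorname{Ap}(S,E)\}\cup\{3a\mid2a\in2A\cap\operatorname{Ap}(S,E)\}$$ $$\cup\Big\{\sum_{i=1}^t\omega_ie_i+a_j\ \Big|\ j\in\{1,\dots,r\},\ \omega\in\operatorname{Hilb}(T_j)\Big\}$$ $$\cup\Big\{\sum_{i=1}^t\omega_ie_i+2a_j\ \Big|\ j\in\{1,\dots,r\},\ 2a_j\in\operatorname{Ap}(S,E),\ \omega\in\operatorname{Hilb}(T'_j)\Big\}.$$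
   Context: Here $p\ge1$ and $\mathbb{N}$ is the set of non-negative integers. An affine semigroup $S\subseteq\mathbb{N}^p$ is a finitely generated submonoid of $\mathbb{N}^p$; $\operatorname{msg}(S)$ is its unique minimal generating set; $\mathcal{C}(S)$ is the set of points of $\mathbb{N}^p$ lying in the cone of non-negative real combinations of $\operatorname{msg}(S)$. The set of multiplicities $\operatorname{Mult}(S)\subseteq\operatorname{msg}(S)$ is the set of minimal elements of $S\setminus\{0\}$ for the order $x\le_{\mathcal{C}(S)}y\iff y-x\in\mathcal{C}(S)$. $S$ is strong if for all $x,y\in S\setminus\{0\}$ with $x\neq y$ there is $e\in\operatorname{Mult}(S)$ with $x+y-e\in S$. $S$ is simplicial if the cone generated by $S$ has dimension $p$ and exactly $p$ extremal rays. $\operatorname{Ap}(S,E)=\{s\in S\mid s-e\notin S\text{ for all }e\in E\}$, and $2A=\{2a\mid a\in A\}$. In the set-builder expressions, $a$ ranges over $A$. Let $\mathbb{K}$ be a field. The monomial $X^\alpha Y^\beta=x_1^{\alpha_1}\cdots x_t^{\alpha_t}y_1^{\beta_1}\cdots y_r^{\beta_r}$ has $S$-degree $\sum_{i=1}^t\alpha_ie_i+\sum_{i=1}^r\beta_ia_i$. The semigroup ideal $I_S\subset\mathbb{K}[x_1,\dots,x_t,y_1,\dots,y_r]$ is the ideal generated by all binomials $X^\alpha Y^\beta-X^\gamma Y^\delta$ whose two monomials have the same $S$-degree. It has minimal generating sets consisting of such binomials; a monomial is indispensable if it appears (as one of the two monomials of some binomial) in every minimal binomial generating set of $I_S$. For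 $m\in S$, $C_m$ is the set of monomials of $S$-degree $m$, and $\sharp$ denotes cardinality. For $j\in\{1,\dots,r\}$, $$T_j=\Big\{\alpha\in\mathbb{N}^t\mid\sharp C_{\sum_{i=1}^t\alpha_ie_i+a_j}\ge2\text{ and }\sharp C_{\sum_{i=1}^t\alpha_ie_i}=1\Big\},$$ $$T'_j=\Big\{\alpha\in\mathbb{N}^t\mid\sharp C_{\sum_{i=1}^t\alpha_ie_i+2a_j}\ge2\text{ and }\sharp C_{\sum_{i=1}^t\alpha_ie_i+a_j}=1\Big\}.$$ For $L\subseteq\mathbb{N}^l$, $\operatorname{Hilb}(L)$ denotes the (finite) set of minimal elements of $L$ for the componentwise partial order on $\mathbb{N}^l$. *)

theory Defs
  imports "HOL-Analysis.Analysis" "HOL-Library.Poly_Mapping"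
begin

definition add_submonoid :: "'a::comm_monoid_add set \<Rightarrow> bool" where
  "add_submonoid T \<longleftrightarrow> 0 \<in> T \<and> (\<forall>x\<in>T. \<forall>y\<in>T. x + y \<in> T)"

definition affine_semigroup :: "(nat ^ 'p) set \<Rightarrow> bool" where
  "affine_semigroup S \<longleftrightarrow> (\<exists>G. finite G \<and> add_submonoid hull G = S)"

definition min_gen_set :: "'a::comm_monoid_add set \<Rightarrow> 'a set \<Rightarrow> bool" where
  "min_gen_set S G \<longleftrightarrow> add_submonoid hull G = S \<and> (\<forall>H. H \<subset> G \<longrightarrow> add_submonoid hull H \<noteq> S)"

definition msg :: "(nat ^ 'p) set \<Rightarrow> (nat ^ 'p) set" where
  "msg S = (THE G. min_gen_set S G)"

text \<open>
  Differences of vectors are taken in \<open>\<int>\<^sup>p\<close>, whereas subtraction on \<^typ>\<open>nat\<close> truncates.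
  For \<open>T \<subseteq> \<nat>\<^sup>p\<close> the condition \<open>x - y \<in> T\<close> is therefore expressed additively.
\<close>

definition diff_in :: "nat ^ 'p \<Rightarrow> nat ^ 'p \<Rightarrow> (nat ^ 'p) set \<Rightarrow> bool" where
  "diff_in x y T \<longleftrightarrow> (\<exists>z\<in>T. x = y + z)"

definition real_vec :: "nat ^ 'p \<Rightarrow> real ^ 'p" where
  "real_vec x = (\<chi> i. real (x $ i))"

text \<open>
  The convex cone hull is the set of non-negative real combinations; it is \<open>{0}\<close> for the empty set.
\<close>

definition real_cone :: "(nat ^ 'p) set \<Rightarrow> (real ^ 'p) set" where
  "real_cone G = convex_cone hull (real_vec ` G)"

definition cone_points :: "(nat ^ 'p) set \<Rightarrow> (nat ^ 'p) set" where
  "cone_points S = {x. real_vec x \<in> real_cone (msg S)}"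

definition cone_le :: "(nat ^ 'p) set \<Rightarrow> nat ^ 'p \<Rightarrow> nat ^ 'p \<Rightarrow> bool" where
  "cone_le S x y \<longleftrightarrow> diff_in y x (cone_points S)"

definition Mult :: "(nat ^ 'p) set \<Rightarrow> (nat ^ 'p) set" where
  "Mult S = {x \<in> S - {0}. \<forall>y \<in> S - {0}. cone_le S y x \<longrightarrow> y = x}"

definition strong :: "(nat ^ 'p) set \<Rightarrow> bool" where
  "strong S \<longleftrightarrow> (\<forall>x \<in> S - {0}. \<forall>y \<in> S - {0}. x \<noteq> y \<longrightarrow> (\<exists>e \<in> Mult S. diff_in (x + y) e S))"

text \<open>
  The cone lies in the non-negative orthant, hence contains no line, so its one-dimensional faces
  (the sets related to it by \<^const>\<open>edge_of\<close>) are exactly its extremal rays.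
\<close>

definition simplicial :: "(nat ^ 'p) set \<Rightarrow> bool" where
  "simplicial S \<longleftrightarrow>
     aff_dim (real_cone S) = int CARD('p) \<and> card {R. R edge_of real_cone S} = CARD('p)"

definition Ap :: "(nat ^ 'p) set \<Rightarrow> (nat ^ 'p) set \<Rightarrow> (nat ^ 'p) set" where
  "Ap S E = {s \<in> S. \<forall>e \<in> E. \<not> diff_in s e S}"

definition Hilb :: "(nat ^ 'l) set \<Rightarrow> (nat ^ 'l) set" where
  "Hilb L = {w \<in> L. \<forall>v \<in> L. v \<le> w \<longrightarrow> v = w}"

text \<open>
  The variables \<open>x\<^sub>i\<close> and \<open>y\<^sub>j\<close> are indexed by \<open>Inl i\<close> and \<open>Inr j\<close>, a monomial is given by its
  exponent vector, and a polynomial is a finitely supported map from exponent vectors to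
  coefficients (with convolution as product), so \<^const>\<open>Poly_Mapping.keys\<close> yields the monomials occurring in
  a polynomial.
\<close>

type_synonym ('t, 'r) mon = "('t + 'r) \<Rightarrow>\<^sub>0 nat"

type_synonym ('t, 'r, 'k) pol = "('t, 'r) mon \<Rightarrow>\<^sub>0 'k"

definition S_degree ::
    "('t::finite \<Rightarrow> nat ^ 'p) \<Rightarrow> ('r::finite \<Rightarrow> nat ^ 'p) \<Rightarrow> ('t, 'r) mon \<Rightarrow> nat ^ 'p" where
  "S_degree e a u =
     (\<Sum>i\<in>UNIV. Poly_Mapping.lookup u (Inl i) *s e i) + (\<Sum>j\<in>UNIV. Poly_Mapping.lookup u (Inr j) *s a j)"

definition fibre ::
    "('t::finite \<Rightarrow> nat ^ 'p) \<Rightarrow> ('r::finite \<Rightarrow> nat ^ 'p) \<Rightarrow> nat ^ 'p \<Rightarrow> ('t, 'r) mon set" where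
  "fibre e a m = {u. S_degree e a u = m}"

definition binomials ::
    "('t::finite \<Rightarrow> nat ^ 'p) \<Rightarrow> ('r::finite \<Rightarrow> nat ^ 'p) \<Rightarrow> ('t, 'r, 'k::field) pol set" where
  "binomials e a =
     {Poly_Mapping.single u 1 - Poly_Mapping.single v 1 | u v. S_degree e a u = S_degree e a v}"

text \<open>Ideals of a commutative ring are its submodules as a module over itself.\<close>

definition ideal_gen :: "'a::comm_ring_1 set \<Rightarrow> 'a set" where
  "ideal_gen B = module.span (*) B"

definition semigroup_ideal ::
    "('t::finite \<Rightarrow> nat ^ 'p) \<Rightarrow> ('r::finite \<Rightarrow> nat ^ 'p) \<Rightarrow> ('t, 'r, 'k::field) pol set" where
  "semigroup_ideal e a = ideal_gen (binomials e a)"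

definition min_binomial_gen_set ::
    "('t::finite \<Rightarrow> nat ^ 'p) \<Rightarrow> ('r::finite \<Rightarrow> nat ^ 'p) \<Rightarrow> ('t, 'r, 'k::field) pol set \<Rightarrow> bool" where
  "min_binomial_gen_set e a B \<longleftrightarrow>
     B \<subseteq> binomials e a \<and> ideal_gen B = semigroup_ideal e a \<and>
     (\<forall>B'. B' \<subset> B \<longrightarrow> ideal_gen B' \<noteq> semigroup_ideal e a)"

text \<open>
  A minimal generating set does not contain the zero polynomial, so the two monomials of each of
  its binomials are distinct and do not cancel.
\<close>

definition indispensable ::
    "'k::field itself \<Rightarrow> ('t::finite \<Rightarrow> nat ^ 'p) \<Rightarrow> ('r::finite \<Rightarrow> nat ^ 'p) \<Rightarrow> ('t, 'r) mon \<Rightarrow> bool"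
  where
  "indispensable _ e a u \<longleftrightarrow>
     (\<forall>B :: ('t, 'r, 'k) pol set. min_binomial_gen_set e a B \<longrightarrow> (\<exists>f\<in>B. u \<in> Poly_Mapping.keys f))"

definition T_set ::
    "('t::finite \<Rightarrow> nat ^ 'p) \<Rightarrow> ('r::finite \<Rightarrow> nat ^ 'p) \<Rightarrow> 'r \<Rightarrow> (nat ^ 't) set" where
  "T_set e a j = {\<alpha>. card (fibre e a ((\<Sum>i\<in>UNIV. \<alpha> $ i *s e i) + a j)) \<ge> 2 \<and>
                      card (fibre e a (\<Sum>i\<in>UNIV. \<alpha> $ i *s e i)) = 1}"

definition T'_set ::
    "('t::finite \<Rightarrow> nat ^ 'p) \<Rightarrow> ('r::finite \<Rightarrow> nat ^ 'p) \<Rightarrow> 'r \<Rightarrow> (nat ^ 't) set" where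
  "T'_set e a j = {\<alpha>. card (fibre e a ((\<Sum>i\<in>UNIV. \<alpha> $ i *s e i) + 2 *s a j)) \<ge> 2 \<and>
                       card (fibre e a ((\<Sum>i\<in>UNIV. \<alpha> $ i *s e i) + a j)) = 1}"

end

theory Submission
  imports Defs
begin

text \<open>
  A monomial is indispensable iff it is minimal, for divisibility, among the monomials sharing their
  degree with another monomial: such a monomial cannot occur in the ideal generated by binomials
  avoiding it, and a non-minimal one can be avoided by factoring every binomial in which it occurs.

  Simpliciality and \<open>\<sharp>E = p\<close> put one element of \<open>E\<close> on each extremal ray, so \<open>E\<close> is a basis whose dual
  functionals are non-negative on \<open>S\<close>. Strongness allows exchanging each of \<open>y\<^sub>j y\<^sub>k\<close>,
  \<open>y\<^sub>j\<^sup>2\<close> (if \<open>2a\<^sub>j\<close> is not an Apery element) and \<open>y\<^sub>j\<^sup>3\<close> (otherwise) for a monomial divisible by some \<open>x\<^sub>i\<close>.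
  These are minimal, and every other minimal monomial is \<open>x\<^sup>\<omega> y\<^sub>j\<close>, \<open>x\<^sup>\<omega> y\<^sub>j\<^sup>2\<close> or
  \<open>x\<^sup>\<omega>\<close>. A minimal \<open>x\<^sup>\<omega>\<close> contributes no new degree, as it shares its degree with one of the
  exchangeable monomials.
\<close>

subsection \<open>Dickson's lemma\<close>

text \<open>Coordinates are treated one at a time. A monotone subsequence exists in the new
  coordinate; if it decreases, it reaches its minimum and is constant from there on, so dropping the
  first \<open>N\<close> terms makes it increasing as well. The coordinates treated before stay
  increasing on subsequences.\<close>

lemma incseq_subsequence_coordinatewise:
  fixes s :: "nat \<Rightarrow> 'i \<Rightarrow> nat"
  assumes "finite I"
  shows "\<exists>r. strict_mono (r :: nat \<Rightarrow> nat) \<and> (\<forall>i\<in>I. incseq (\<lambda>n. s (r n) i))"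
  using assms
proof (induction I)
  case empty
  then show ?case using strict_mono_id by auto
next
  case (insert i I)
  then obtain r where r: "strict_mono (r :: nat \<Rightarrow> nat)" "\<And>j. j \<in> I \<Longrightarrow> incseq (\<lambda>n. s (r n) j)"
    by blast
  obtain f where f: "strict_mono (f :: nat \<Rightarrow> nat)" "monoseq (\<lambda>n. s (r (f n)) i)"
    using seq_monosub[of "\<lambda>n. s (r n) i"] by blast
  have "\<exists>N. incseq (\<lambda>n. s (r (f (n + N))) i)"
  proof (cases "incseq (\<lambda>n. s (r (f n)) i)")
    case True
    then show ?thesis by (intro exI[of _ 0]) simp
  next
    case False
    then have dec: "decseq (\<lambda>n. s (r (f n)) i)"
      using f(2) monoseq_iff by blast
    obtain N where "\<forall>n. s (r (f N)) i \<le> s (r (f n)) i"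
      using ex_has_least_nat[of "\<lambda>_. True" 0 "\<lambda>n. s (r (f n)) i"] by auto
    then have "s (r (f (n + N))) i = s (r (f N)) i" for n
      using decseqD[OF dec, of N "n + N"] by (simp add: antisym)
    then show ?thesis by (intro exI[of _ N]) (simp add: incseq_def)
  qed
  then obtain N where N: "incseq (\<lambda>n. s (r (f (n + N))) i)" by blast
  have sm: "strict_mono (\<lambda>n. f (n + N))"
    using f(1) by (simp add: strict_mono_def)
  have "incseq (\<lambda>n. s (r (f (n + N))) j)" if "j \<in> I" for j
    unfolding incseq_def
    using r(2)[OF that] sm by (meson incseqD strict_mono_less_eq)
  moreover have "strict_mono (\<lambda>n. r (f (n + N)))"
    using r(1) sm by (simp add: strict_mono_def)
  ultimately show ?case using N by (intro exI[of _ "\<lambda>n. r (f (n + N))"]) auto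
qed

text \<open>An injective sequence in an infinite \<open>L\<close> would have an increasing
  subsequence, whose first two terms are comparable and hence equal.\<close>

lemma finite_antichain_nat_functions:
  fixes L :: "('i::finite \<Rightarrow> nat) set"
  assumes "\<And>x y. x \<in> L \<Longrightarrow> y \<in> L \<Longrightarrow> x \<le> y \<Longrightarrow> x = y"
  shows "finite L"
proof (rule ccontr)
  assume "infinite L"
  then obtain s :: "nat \<Rightarrow> 'i \<Rightarrow> nat" where s: "inj s" "range s \<subseteq> L"
    using infinite_countable_subset by blast
  obtain r where r: "strict_mono (r :: nat \<Rightarrow> nat)" "\<And>i. incseq (\<lambda>n. s (r n) i)"
    using incseq_subsequence_coordinatewise[of UNIV s] by auto
  have "s (r 0) \<le> s (r 1)"
    using incseqD[OF r(2), of 0 1] by (simp add: le_fun_def)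
  then have "s (r 0) = s (r 1)"
    using s(2) assms by blast
  then have "r 0 = r 1" using s(1) by (simp add: inj_eq)
  then show False using strict_monoD[OF r(1), of 0 1] by simp
qed

subsection \<open>Monomials and their degrees\<close>

lemma S_degree_0 [simp]: "S_degree e a 0 = 0"
  by (simp add: S_degree_def)

lemma S_degree_add: "S_degree e a (u + v) = S_degree e a u + S_degree e a v"
  by (simp add: S_degree_def lookup_add vector_sadd_rdistrib sum.distrib algebra_simps)

lemma pm_diff_add:
  fixes u w :: "'i \<Rightarrow>\<^sub>0 nat"
  assumes "\<And>x. Poly_Mapping.lookup w x \<le> Poly_Mapping.lookup u x"
  shows "u = w + (u - w)"
  by (rule poly_mapping_eqI) (simp add: lookup_add lookup_minus assms)

definition mon_size :: "('i::finite \<Rightarrow>\<^sub>0 nat) \<Rightarrow> nat" where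
  "mon_size u = (\<Sum>x\<in>UNIV. Poly_Mapping.lookup u x)"

lemma mon_size_add [simp]: "mon_size (u + v) = mon_size u + mon_size v"
  by (simp add: mon_size_def lookup_add sum.distrib)

lemma mon_size_eq_0 [simp]: "mon_size u = 0 \<longleftrightarrow> u = 0"
  by (auto simp: mon_size_def intro: poly_mapping_eqI)

subsection \<open>Generators of the semigroup ideal\<close>

lemma module_times: "module ((*) :: 'a::comm_ring_1 \<Rightarrow> 'a \<Rightarrow> 'a)"
  by unfold_locales (simp_all add: algebra_simps)

lemma
  fixes B :: "'a::comm_ring_1 set"
  shows ideal_gen_base: "f \<in> B \<Longrightarrow> f \<in> ideal_gen B"
    and ideal_gen_0: "0 \<in> ideal_gen B"
    and ideal_gen_add: "f \<in> ideal_gen B \<Longrightarrow> g \<in> ideal_gen B \<Longrightarrow> f + g \<in> ideal_gen B"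
    and ideal_gen_mult: "f \<in> ideal_gen B \<Longrightarrow> h * f \<in> ideal_gen B"
    and ideal_gen_mono: "B \<subseteq> C \<Longrightarrow> ideal_gen B \<subseteq> ideal_gen C"
    and ideal_gen_subsetI: "B \<subseteq> ideal_gen C \<Longrightarrow> ideal_gen B \<subseteq> ideal_gen C"
proof -
  interpret module "(*) :: 'a \<Rightarrow> 'a \<Rightarrow> 'a" by (rule module_times)
  show "f \<in> B \<Longrightarrow> f \<in> ideal_gen B" "0 \<in> ideal_gen B"
    "f \<in> ideal_gen B \<Longrightarrow> g \<in> ideal_gen B \<Longrightarrow> f + g \<in> ideal_gen B"
    "f \<in> ideal_gen B \<Longrightarrow> h * f \<in> ideal_gen B"
    "B \<subseteq> C \<Longrightarrow> ideal_gen B \<subseteq> ideal_gen C"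
    "B \<subseteq> ideal_gen C \<Longrightarrow> ideal_gen B \<subseteq> ideal_gen C"
    unfolding ideal_gen_def
    by (auto intro: span_base span_zero span_add span_scale span_minimal simp: span_mono
        dest: span_mono span_minimal[OF _ subspace_span])
qed

lemma ideal_gen_induct [consumes 1, case_names zero add mult]:
  fixes B :: "'a::comm_ring_1 set"
  assumes "f \<in> ideal_gen B" "P 0" "\<And>f g. P f \<Longrightarrow> P g \<Longrightarrow> P (f + g)"
    and "\<And>h f. f \<in> B \<Longrightarrow> P (h * f)"
  shows "P f"
proof -
  interpret module "(*) :: 'a \<Rightarrow> 'a \<Rightarrow> 'a" by (rule module_times)
  show ?thesis
    using assms(1) unfolding ideal_gen_def
    by (induction rule: span_induct_alt) (use assms in auto)
qed

text \<open>Membership in an ideal involves only finitely many generators; this is what allows a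
  possibly infinite generating set to be cut down to a finite one.\<close>

lemma ideal_gen_finite_subset:
  fixes B :: "'a::comm_ring_1 set"
  assumes "f \<in> ideal_gen B"
  shows "\<exists>F. finite F \<and> F \<subseteq> B \<and> f \<in> ideal_gen F"
  using assms
proof (induction rule: ideal_gen_induct)
  case zero
  then show ?case using ideal_gen_0 by blast
next
  case (add f g)
  then obtain F G where "finite F" "F \<subseteq> B" "f \<in> ideal_gen F" "finite G" "G \<subseteq> B" "g \<in> ideal_gen G"
    by blast
  then show ?case
    using ideal_gen_mono[of F "F \<union> G"] ideal_gen_mono[of G "F \<union> G"]
    by (intro exI[of _ "F \<union> G"]) (auto intro!: ideal_gen_add)
next
  case (mult h f)
  then show ?case
    by (intro exI[of _ "{f}"] conjI ideal_gen_mult ideal_gen_base) auto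
qed

abbreviation bin :: "'m \<Rightarrow> 'm \<Rightarrow> 'm \<Rightarrow>\<^sub>0 'k::comm_ring_1" where
  "bin u v \<equiv> Poly_Mapping.single u 1 - Poly_Mapping.single v 1"

text \<open>The difference telescopes through the intermediate monomial
  \<open>v + u'\<close>.\<close>

lemma bin_add:
  "bin (u + u') (v + v') = Poly_Mapping.single u' (1::'k::comm_ring_1) * bin u v
     + Poly_Mapping.single (v :: 'm::comm_monoid_add) 1 * bin u' v'"
  by (simp add: algebra_simps mult_single)

lemma ideal_gen_bin_add:
  fixes B :: "('m::comm_monoid_add \<Rightarrow>\<^sub>0 'k::comm_ring_1) set"
  assumes "bin u v \<in> ideal_gen B" "bin u' v' \<in> ideal_gen B"
  shows "bin (u + u') (v + v') \<in> ideal_gen B"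
  unfolding bin_add by (intro ideal_gen_add ideal_gen_mult assms)

text \<open>The pairs of monomials of equal degree form a submonoid, generated by its minimal nonzero
  elements, of which there are finitely many by Dickson's lemma.\<close>

lemma semigroup_ideal_finitely_generated:
  fixes e :: "'t::finite \<Rightarrow> nat ^ 'p" and a :: "'r::finite \<Rightarrow> nat ^ 'p"
  shows "\<exists>F :: ('t, 'r, 'k::field) pol set.
    finite F \<and> F \<subseteq> binomials e a \<and> semigroup_ideal e a \<subseteq> ideal_gen F"
proof -
  define D where "D = {(u, v). S_degree e a u = S_degree e a v \<and> \<not> (u = 0 \<and> v = 0)}"
  \<comment> \<open>A pair becomes one exponent function on two copies of the variables, so that the
    pointwise order is simultaneous divisibility in both components.\<close>
  define enc where "enc = (\<lambda>(u :: ('t, 'r) mon, v :: ('t, 'r) mon).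
    case_sum (Poly_Mapping.lookup u) (Poly_Mapping.lookup v))"
  define Min where "Min = {d \<in> D. \<forall>d' \<in> D. enc d' \<le> enc d \<longrightarrow> d' = d}"
  define F where "F = (\<lambda>(u, v). bin u v :: ('t, 'r, 'k) pol) ` Min"
  have inj: "inj enc"
    by (auto simp: enc_def inj_def fun_eq_iff poly_mapping_eq_iff split: prod.splits)
      (metis sum.case(1), metis sum.case(2))
  have "finite (enc ` Min)"
    by (rule finite_antichain_nat_functions) (auto simp: Min_def)
  then have "finite Min"
    using inj by (meson finite_imageD inj_on_subset subset_UNIV)
  have gen: "bin u v \<in> ideal_gen F" if "S_degree e a u = S_degree e a v" for u v
    using that
  proof (induction "mon_size u + mon_size v" arbitrary: u v rule: less_induct)
    case less
    show ?case
    proof (cases "(u, v) \<in> D")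
      case False
      then have "u = v" using less.prems by (auto simp: D_def)
      then show ?thesis by (simp add: ideal_gen_0)
    next
      case True
      show ?thesis
      proof (cases "(u, v) \<in> Min")
        case True
        then show ?thesis unfolding F_def by (intro ideal_gen_base) force
      next
        case False
        then obtain u' v' where d: "(u', v') \<in> D" "enc (u', v') \<le> enc (u, v)" "(u', v') \<noteq> (u, v)"
          using True by (auto simp: Min_def)
        have le: "Poly_Mapping.lookup u' x \<le> Poly_Mapping.lookup u x" "Poly_Mapping.lookup v' x \<le> Poly_Mapping.lookup v x" for x
          using le_funD[OF d(2), of "Inl x"] le_funD[OF d(2), of "Inr x"] by (simp_all add: enc_def)
        \<comment> \<open>The complementary pair again has equal degrees by cancellation. Neither
          pair is trivial, so both are strictly smaller in total size.\<close>
        define u'' v'' where uv'': "u'' = u - u'" "v'' = v - v'"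
        have u: "u = u' + u''" and v: "v = v' + v''"
          using pm_diff_add[of u' u] pm_diff_add[of v' v] le uv'' by auto
        have deg': "S_degree e a u' = S_degree e a v'" using d(1) by (simp add: D_def)
        then have deg'': "S_degree e a u'' = S_degree e a v''"
          using less.prems by (simp add: u v S_degree_add)
        have "mon_size u'' + mon_size v'' \<noteq> 0"
          using d(3) u v by auto
        moreover have "mon_size u' + mon_size v' \<noteq> 0"
          using d(1) by (auto simp: D_def)
        ultimately have "mon_size u' + mon_size v' < mon_size u + mon_size v"
          "mon_size u'' + mon_size v'' < mon_size u + mon_size v"
          unfolding u v mon_size_add by linarith+
        then have "bin u' v' \<in> ideal_gen F" "bin u'' v'' \<in> ideal_gen F"
          using less.hyps[OF _ deg'] less.hyps[OF _ deg''] by blast+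
        then show ?thesis unfolding u v by (rule ideal_gen_bin_add)
      qed
    qed
  qed
  have "finite F" using \<open>finite Min\<close> by (simp add: F_def)
  moreover have "F \<subseteq> binomials e a"
    by (auto simp: F_def Min_def D_def binomials_def)
  moreover have "binomials e a \<subseteq> ideal_gen F"
    using gen by (auto simp: binomials_def)
  ultimately show ?thesis
    by (intro exI[of _ F]) (simp add: semigroup_ideal_def ideal_gen_subsetI)
qed

text \<open>A descending search in \<open>B\<close> need not stop if \<open>B\<close> is infinite.
  Therefore each element of a finite generating set is first written with finitely many elements of
  \<open>B\<close>; these form a finite generating set \<open>H\<close>, and a generating subset of
  \<open>H\<close> of least cardinality is minimal.\<close>

lemma min_binomial_gen_set_exists:
  fixes e :: "'t::finite \<Rightarrow> nat ^ 'p" and a :: "'r::finite \<Rightarrow> nat ^ 'p"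
    and B :: "('t, 'r, 'k::field) pol set"
  assumes "B \<subseteq> binomials e a" "ideal_gen B = semigroup_ideal e a"
  shows "\<exists>C \<subseteq> B. min_binomial_gen_set e a C"
proof -
  obtain F :: "('t, 'r, 'k) pol set" where F: "finite F" "F \<subseteq> binomials e a"
    "semigroup_ideal e a \<subseteq> ideal_gen F"
    using semigroup_ideal_finitely_generated[of e a] by metis
  have "\<exists>G. finite G \<and> G \<subseteq> B \<and> f \<in> ideal_gen G" if "f \<in> F" for f
    using that F(2) ideal_gen_finite_subset[of f B] ideal_gen_base[of f "binomials e a"] assms(2)
    unfolding semigroup_ideal_def by auto
  then obtain G where G: "\<And>f. f \<in> F \<Longrightarrow> finite (G f) \<and> G f \<subseteq> B \<and> f \<in> ideal_gen (G f)"
    by metis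
  define H where "H = (\<Union>f\<in>F. G f)"
  have H: "finite H" "H \<subseteq> B" using F(1) G by (auto simp: H_def)
  have "F \<subseteq> ideal_gen H"
    using G ideal_gen_mono[of "G _" H] by (fastforce simp: H_def)
  then have "semigroup_ideal e a \<subseteq> ideal_gen H"
    using F(3) ideal_gen_subsetI by blast
  moreover have sub: "ideal_gen C \<subseteq> semigroup_ideal e a" if "C \<subseteq> B" for C
    using ideal_gen_mono[OF that] assms(2) by simp
  ultimately have "ideal_gen H = semigroup_ideal e a" using H(2) by blast
  then obtain C where C: "C \<subseteq> H" "ideal_gen C = semigroup_ideal e a"
    and least: "\<And>C'. C' \<subseteq> H \<and> ideal_gen C' = semigroup_ideal e a \<Longrightarrow> card C \<le> card C'"
    using ex_has_least_nat[of "\<lambda>C. C \<subseteq> H \<and> ideal_gen C = semigroup_ideal e a" H card] by auto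
  have "ideal_gen C' \<noteq> semigroup_ideal e a" if "C' \<subset> C" for C'
    using least[of C'] psubset_card_mono[OF finite_subset[OF C(1) H(1)] that] that C(1) by auto
  then have "min_binomial_gen_set e a C"
    unfolding min_binomial_gen_set_def using C H(2) assms(1) by blast
  then show ?thesis using C(1) H(2) by blast
qed

subsection \<open>Indispensable monomials\<close>

definition nonunique :: "('t::finite \<Rightarrow> nat ^ 'p) \<Rightarrow> ('r::finite \<Rightarrow> nat ^ 'p) \<Rightarrow> ('t, 'r) mon \<Rightarrow> bool"
  where "nonunique e a u \<longleftrightarrow> (\<exists>v. v \<noteq> u \<and> S_degree e a v = S_degree e a u)"

lemma nonunique_add: "nonunique e a u \<Longrightarrow> nonunique e a (u + w)"
  unfolding nonunique_def by (metis S_degree_add add_right_cancel)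

text \<open>Since \<open>u = v + w\<close> expresses divisibility, these are the minimal generators
  of the monomial ideal generated by the monomials that are not alone in their fibre.\<close>

definition min_nonunique ::
    "('t::finite \<Rightarrow> nat ^ 'p) \<Rightarrow> ('r::finite \<Rightarrow> nat ^ 'p) \<Rightarrow> ('t, 'r) mon \<Rightarrow> bool" where
  "min_nonunique e a u \<longleftrightarrow> nonunique e a u \<and> (\<forall>v w. u = v + w \<longrightarrow> nonunique e a v \<longrightarrow> w = 0)"

lemma keys_bin:
  "u \<noteq> v \<Longrightarrow> Poly_Mapping.keys (bin u v :: 'm \<Rightarrow>\<^sub>0 'k::comm_ring_1) = {u, v}"
  by (auto simp: in_keys_iff lookup_minus lookup_single when_def split: if_splits)

text \<open>If \<open>u\<close> is in no element of \<open>B\<close>, then by minimality no divisor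
  of \<open>u\<close> is in an element of \<open>B\<close> either. This property passes to the whole
  ideal, contradicting that \<open>bin u v\<close> belongs to it.\<close>

lemma min_nonunique_imp_indispensable:
  fixes e :: "'t::finite \<Rightarrow> nat ^ 'p" and a :: "'r::finite \<Rightarrow> nat ^ 'p"
  assumes "min_nonunique e a u"
  shows "indispensable TYPE('k::field) e a u"
  unfolding indispensable_def
proof (intro allI impI, rule ccontr)
  fix B :: "('t, 'r, 'k) pol set"
  assume B: "min_binomial_gen_set e a B" and none: "\<not> (\<exists>f\<in>B. u \<in> Poly_Mapping.keys f)"
  obtain v where v: "v \<noteq> u" "S_degree e a v = S_degree e a u"
    using assms by (auto simp: min_nonunique_def nonunique_def)
  have base: "q \<notin> Poly_Mapping.keys f" if "f \<in> B" "u = q + w" for f q w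
  proof
    assume q: "q \<in> Poly_Mapping.keys f"
    have "f \<in> binomials e a" using B that(1) by (auto simp: min_binomial_gen_set_def)
    then obtain b c where bc: "f = bin b c" "S_degree e a b = S_degree e a c"
      by (auto simp: binomials_def)
    have "b \<noteq> c" using q bc(1) by auto
    then have "q = b \<or> q = c" using q unfolding bc(1) by (simp add: keys_bin)
    then have "nonunique e a q" using bc(2) \<open>b \<noteq> c\<close> by (auto simp: nonunique_def)
    then have "w = 0" using assms that(2) by (auto simp: min_nonunique_def)
    then show False using none that q by auto
  qed
  \<comment> \<open>The claim covers all divisors \<open>q\<close> of \<open>u\<close>, not only
    \<open>u\<close>, because a monomial of \<open>h * f\<close> has a monomial of \<open>f\<close>
    merely as a divisor.\<close>
  have "\<forall>q w. u = q + w \<longrightarrow> q \<notin> Poly_Mapping.keys f" if "f \<in> ideal_gen B" for f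
    using that
  proof (induction rule: ideal_gen_induct)
    case (add f g)
    then show ?case using keys_add[of f g] by blast
  next
    case (mult h f)
    show ?case
    proof (intro allI impI notI)
      fix q w assume "u = q + w" "q \<in> Poly_Mapping.keys (h * f)"
      then obtain b c where "q = b + c" "c \<in> Poly_Mapping.keys f" using keys_mult[of h f] by blast
      then show False using base[OF mult, of c "b + w"] \<open>u = q + w\<close> by (simp add: ac_simps)
    qed
  qed simp
  moreover have "bin u v \<in> ideal_gen B"
  proof -
    have "(bin u v :: ('t, 'r, 'k) pol) \<in> binomials e a"
      unfolding binomials_def mem_Collect_eq using v(2) by (intro exI[of _ u] exI[of _ v]) simp
    then show ?thesis
      using B ideal_gen_base unfolding min_binomial_gen_set_def semigroup_ideal_def by blast
  qed
  ultimately have "u \<notin> Poly_Mapping.keys (bin u v :: ('t, 'r, 'k) pol)" by fastforce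
  then show False using v(1) keys_bin[of u v] by auto
qed

text \<open>If \<open>u\<close> is not minimal, the binomials avoiding \<open>u\<close> still
  generate the ideal, and a minimal generating set chosen among them does not contain
  \<open>u\<close>.\<close>

lemma indispensable_imp_min_nonunique:
  fixes e :: "'t::finite \<Rightarrow> nat ^ 'p" and a :: "'r::finite \<Rightarrow> nat ^ 'p"
  assumes pos: "\<And>w. S_degree e a w = 0 \<Longrightarrow> w = 0"
    and ind: "indispensable TYPE('k::field) e a u"
  shows "min_nonunique e a u"
proof (rule ccontr)
  assume not_min: "\<not> min_nonunique e a u"
  define B where "B = {bin b c :: ('t, 'r, 'k) pol | b c.
    S_degree e a b = S_degree e a c \<and> b \<noteq> u \<and> c \<noteq> u}"
  have B: "bin b c \<in> ideal_gen B" if "S_degree e a b = S_degree e a c" "b \<noteq> u" "c \<noteq> u" for b c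
    using that by (intro ideal_gen_base) (auto simp: B_def)
  have u: "bin u v \<in> ideal_gen B" if v: "S_degree e a v = S_degree e a u" "v \<noteq> u" for v
  proof -
    have "nonunique e a u" using v by (auto simp: nonunique_def)
    then obtain q w where q: "u = q + w" "nonunique e a q" "w \<noteq> 0"
      using not_min by (auto simp: min_nonunique_def)
    then obtain q' where q': "q' \<noteq> q" "S_degree e a q' = S_degree e a q"
      by (auto simp: nonunique_def)
    \<comment> \<open>The cofactor \<open>w\<close> has nonzero degree, so \<open>q\<close> and
      \<open>q'\<close> lie in another fibre than \<open>u\<close> and \<open>bin q q'\<close> is
      available.\<close>
    have "S_degree e a q \<noteq> S_degree e a u" using q(1,3) pos by (auto simp: S_degree_add)
    then have ne: "q \<noteq> u" "q' \<noteq> u" using q'(2) by auto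
    \<comment> \<open>The passage from \<open>u\<close> to \<open>v\<close> makes a detour through
      \<open>q' + w\<close>, which differs from \<open>u\<close> as \<open>q' \<noteq> q\<close>:
      the first leg is a multiple of \<open>bin q q'\<close>, the second avoids
      \<open>u\<close>.\<close>
    have "bin (q + w) (q' + w) \<in> ideal_gen B"
      by (rule ideal_gen_bin_add) (use B ne q' in \<open>auto simp: ideal_gen_0\<close>)
    moreover have "bin (q' + w) v \<in> ideal_gen B"
      by (rule B) (use q q' v in \<open>auto simp: S_degree_add\<close>)
    ultimately have "bin (q + w) (q' + w) + bin (q' + w) v \<in> ideal_gen B" by (rule ideal_gen_add)
    then show ?thesis using q(1) by simp
  qed
  have u': "bin v u \<in> ideal_gen B" if "S_degree e a v = S_degree e a u" "v \<noteq> u" for v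
    using ideal_gen_mult[OF u[OF that], of "- 1"] by simp
  have "bin b c \<in> ideal_gen B" if "S_degree e a b = S_degree e a c" for b c
    using that B[of b c] u[of c] u'[of b] ideal_gen_0[of B] by (cases "b = u"; cases "c = u") auto
  then have "semigroup_ideal e a \<subseteq> ideal_gen B"
    unfolding semigroup_ideal_def by (intro ideal_gen_subsetI) (auto simp: binomials_def)
  moreover have sub: "B \<subseteq> binomials e a" by (auto simp: B_def binomials_def)
  ultimately have "ideal_gen B = semigroup_ideal e a"
    using ideal_gen_mono[of B "binomials e a"] by (auto simp: semigroup_ideal_def)
  then obtain C where "C \<subseteq> B" "min_binomial_gen_set e a C"
    using min_binomial_gen_set_exists[OF sub] by blast
  then obtain f where "f \<in> B" "u \<in> Poly_Mapping.keys f" using ind unfolding indispensable_def by blast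
  then obtain b c where "u \<in> Poly_Mapping.keys (bin b c :: ('t, 'r, 'k) pol)" "b \<noteq> u" "c \<noteq> u"
    by (auto simp: B_def)
  then show False by (cases "b = c") (auto simp: keys_bin)
qed

subsection \<open>Irreducible elements of an affine semigroup\<close>

definition irreducibles :: "'a::comm_monoid_add set \<Rightarrow> 'a set" where
  "irreducibles S = {s \<in> S - {0}. \<forall>x \<in> S - {0}. \<forall>y \<in> S - {0}. s \<noteq> x + y}"

lemma add_submonoid_hull: "add_submonoid (add_submonoid hull G)"
  by (rule hull_in) (auto simp: add_submonoid_def)

text \<open>Removing an irreducible element from \<open>S\<close> leaves a submonoid; if the element
  were not in \<open>G\<close>, this smaller submonoid would contain \<open>G\<close>.\<close>

lemma irreducibles_subset_generators:
  assumes "add_submonoid hull G = S"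
  shows "irreducibles S \<subseteq> G"
proof
  fix s assume s: "s \<in> irreducibles S"
  show "s \<in> G"
  proof (rule ccontr)
    assume "s \<notin> G"
    then have "G \<subseteq> S - {s}" using hull_subset[of G add_submonoid] assms by auto
    moreover have "add_submonoid (S - {s})"
      using s add_submonoid_hull[of G] unfolding assms add_submonoid_def irreducibles_def
      by (smt (verit) Diff_iff add.left_neutral add.right_neutral empty_iff insert_iff mem_Collect_eq)
    ultimately have "S \<subseteq> S - {s}" using hull_minimal assms by blast
    then show False using s by (auto simp: irreducibles_def)
  qed
qed

definition vec_size :: "nat ^ 'p \<Rightarrow> nat" where
  "vec_size x = (\<Sum>i\<in>UNIV. x $ i)"

lemma vec_size_add [simp]: "vec_size (x + y) = vec_size x + vec_size y"
  by (simp add: vec_size_def sum.distrib)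

lemma vec_size_eq_0 [simp]: "vec_size x = 0 \<longleftrightarrow> x = 0"
  by (auto simp: vec_size_def vec_eq_iff)

lemma vec_size_pos [simp]: "0 < vec_size x \<longleftrightarrow> x \<noteq> 0"
  by (simp flip: neq0_conv)

text \<open>A reducible element splits into two nonzero summands of smaller coordinate sum, so
  repeated splitting ends in irreducibles.\<close>

lemma hull_irreducibles:
  fixes S :: "(nat ^ 'p) set"
  assumes "add_submonoid S"
  shows "add_submonoid hull (irreducibles S) = S"
proof
  show "add_submonoid hull (irreducibles S) \<subseteq> S"
    by (rule hull_minimal) (use assms in \<open>auto simp: irreducibles_def\<close>)
  have "s \<in> add_submonoid hull (irreducibles S)" if "s \<in> S" for s
    using that
  proof (induction "vec_size s" arbitrary: s rule: less_induct)
    case less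
    show ?case
    proof (cases "s = 0 \<or> s \<in> irreducibles S")
      case True
      then show ?thesis
        using add_submonoid_hull[of "irreducibles S"]
        by (auto simp: add_submonoid_def intro: hull_inc)
    next
      case False
      then obtain x y where xy: "x \<in> S" "y \<in> S" "x \<noteq> 0" "y \<noteq> 0" "s = x + y"
        using less.prems by (auto simp: irreducibles_def)
      then have "vec_size x < vec_size s" "vec_size y < vec_size s" by simp_all
      then show ?thesis
        using less.hyps xy add_submonoid_hull[of "irreducibles S"]
        by (auto simp: add_submonoid_def)
    qed
  qed
  then show "S \<subseteq> add_submonoid hull (irreducibles S)" by blast
qed

lemma affine_semigroup_submonoid: "affine_semigroup S \<Longrightarrow> add_submonoid S"
  using add_submonoid_hull by (auto simp: affine_semigroup_def)

lemma finite_irreducibles: "affine_semigroup S \<Longrightarrow> finite (irreducibles S)"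
  using irreducibles_subset_generators finite_subset unfolding affine_semigroup_def by metis

text \<open>The irreducibles generate \<open>S\<close> and lie in every generating set. This gives
  both the existence and the uniqueness behind the definite description in
  \<open>msg\<close>.\<close>

lemma msg_eq_irreducibles:
  assumes "affine_semigroup S"
  shows "msg S = irreducibles S"
  unfolding msg_def
proof (rule the_equality)
  have gen: "add_submonoid hull (irreducibles S) = S"
    using assms by (intro hull_irreducibles affine_semigroup_submonoid)
  then show "min_gen_set S (irreducibles S)"
    using irreducibles_subset_generators unfolding min_gen_set_def by blast
  show "G = irreducibles S" if "min_gen_set S G" for G
    using that gen irreducibles_subset_generators[of G S] unfolding min_gen_set_def by blast
qed

subsection \<open>Extremal rays of pointed cones\<close>

text \<open>The non-negative combinations of \<open>G\<close> themselves form a convex cone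
  containing \<open>G\<close>.\<close>

lemma convex_cone_hull_finite:
  fixes G :: "'a::real_vector set"
  assumes "finite G" "x \<in> convex_cone hull G"
  shows "\<exists>c. (\<forall>g\<in>G. 0 \<le> c g) \<and> x = (\<Sum>g\<in>G. c g *\<^sub>R g)"
  using assms(2)
proof (rule hull_induct)
  fix x assume "x \<in> G"
  then show "\<exists>c. (\<forall>g\<in>G. 0 \<le> c g) \<and> x = (\<Sum>g\<in>G. c g *\<^sub>R g)"
    using assms(1)
    by (intro exI[of _ "\<lambda>g. if g = x then 1 else 0"]) (simp add: if_distrib[of "\<lambda>c. c *\<^sub>R _"] cong: if_cong)
next
  show "convex_cone {x. \<exists>c. (\<forall>g\<in>G. 0 \<le> c g) \<and> x = (\<Sum>g\<in>G. c g *\<^sub>R g)}" (is "convex_cone ?C")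
    unfolding convex_cone_iff
  proof (intro conjI ballI allI impI)
    show "0 \<in> ?C" by (auto intro!: exI[of _ "\<lambda>_. 0"])
    show "x + y \<in> ?C" if "x \<in> ?C" "y \<in> ?C" for x y
    proof -
      from that obtain c d where "\<forall>g\<in>G. 0 \<le> c g" "x = (\<Sum>g\<in>G. c g *\<^sub>R g)"
        "\<forall>g\<in>G. 0 \<le> d g" "y = (\<Sum>g\<in>G. d g *\<^sub>R g)" by blast
      then show ?thesis
        by (auto intro!: exI[of _ "\<lambda>g. c g + d g"] simp: scaleR_add_left sum.distrib)
    qed
    show "t *\<^sub>R x \<in> ?C" if "x \<in> ?C" "0 \<le> t" for x t
    proof -
      from that obtain c where "\<forall>g\<in>G. 0 \<le> c g" "x = (\<Sum>g\<in>G. c g *\<^sub>R g)" by blast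
      then show ?thesis using that(2)
        by (auto intro!: exI[of _ "\<lambda>g. t * c g"] simp: scaleR_sum_right)
    qed
  qed
qed

lemma convex_cone_hull_sum:
  assumes "\<And>g. g \<in> F \<Longrightarrow> 0 \<le> c g" "F \<subseteq> G"
  shows "(\<Sum>g\<in>F. c g *\<^sub>R g) \<in> convex_cone hull G"
  using assms
  by (induction F rule: infinite_finite_induct)
    (auto intro: convex_cone_hull_add convex_cone_hull_mul hull_inc simp: convex_cone_hull_contains_0)

definition ray :: "'a::real_vector \<Rightarrow> 'a set" where
  "ray h = (\<lambda>t. t *\<^sub>R h) ` {0..}"

lemma ray_scaleR: "0 \<le> t \<Longrightarrow> x \<in> ray h \<Longrightarrow> t *\<^sub>R x \<in> ray h"
  by (auto simp: ray_def intro!: image_eqI[where x = "t * _"])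

text \<open>Comparing coefficients, the part \<open>s\<close> of \<open>x + y\<close> outside
  \<open>h\<close> is a multiple of \<open>h\<close>. A positive factor would make \<open>h\<close>
  redundant. Otherwise \<open>w\<close> is at most 0 on \<open>s\<close>, and since \<open>w\<close>
  is positive on every generator, all coefficients outside \<open>h\<close> vanish.\<close>

lemma ray_summand:
  fixes w :: "'a::euclidean_space"
  assumes H: "finite H" "h \<in> H" "h \<notin> convex_cone hull (H - {h})"
    and pos: "\<And>g. g \<in> H \<Longrightarrow> 0 < w \<bullet> g"
    and xy: "x \<in> convex_cone hull H" "y \<in> convex_cone hull H" "x + y \<in> ray h"
  shows "x \<in> ray h"
proof -
  obtain c where c: "\<And>g. g \<in> H \<Longrightarrow> 0 \<le> c g" "x = (\<Sum>g\<in>H. c g *\<^sub>R g)"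
    using convex_cone_hull_finite[OF H(1) xy(1)] by blast
  obtain d where d: "\<And>g. g \<in> H \<Longrightarrow> 0 \<le> d g" "y = (\<Sum>g\<in>H. d g *\<^sub>R g)"
    using convex_cone_hull_finite[OF H(1) xy(2)] by blast
  obtain t where t: "0 \<le> t" "x + y = t *\<^sub>R h" using xy(3) by (auto simp: ray_def)
  define s where "s = (\<Sum>g\<in>H-{h}. (c g + d g) *\<^sub>R g)"
  have "x + y = (c h + d h) *\<^sub>R h + s"
    unfolding c(2) d(2) s_def by (simp add: sum.remove[OF H(1,2)] scaleR_add_left sum.distrib algebra_simps)
  then have s: "s = (t - (c h + d h)) *\<^sub>R h" using t(2) by (simp add: algebra_simps)
  have nonpos: "t - (c h + d h) \<le> 0"
  proof (rule ccontr)
    assume *: "\<not> t - (c h + d h) \<le> 0"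
    have "s \<in> convex_cone hull (H - {h})"
      unfolding s_def using c(1) d(1) by (intro convex_cone_hull_sum) auto
    then have "(1 / (t - (c h + d h))) *\<^sub>R s \<in> convex_cone hull (H - {h})"
      using * by (intro convex_cone_hull_mul) auto
    then show False using * H(3) by (simp add: s)
  qed
  have "w \<bullet> s = (\<Sum>g\<in>H-{h}. (c g + d g) * (w \<bullet> g))" by (simp add: s_def inner_sum_right)
  moreover have "w \<bullet> s \<le> 0"
    using nonpos pos[OF H(2)] by (simp add: s mult_nonpos_nonneg)
  moreover have nn: "0 \<le> (c g + d g) * (w \<bullet> g)" if "g \<in> H - {h}" for g
    using that c(1)[of g] d(1)[of g] pos[of g] by simp
  ultimately have "(\<Sum>g\<in>H-{h}. (c g + d g) * (w \<bullet> g)) = 0"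
    using sum_nonneg[of "H - {h}" "\<lambda>g. (c g + d g) * (w \<bullet> g)"] by force
  then have "(c g + d g) * (w \<bullet> g) = 0" if "g \<in> H - {h}" for g
    using that nn H(1) sum_nonneg_eq_0_iff[of "H - {h}" "\<lambda>g. (c g + d g) * (w \<bullet> g)"] by auto
  then have "c g = 0" if "g \<in> H - {h}" for g
    using that c(1)[of g] d(1)[of g] pos[of g] by fastforce
  then have "x = c h *\<^sub>R h"
    unfolding c(2) by (simp add: sum.remove[OF H(1,2)])
  then show ?thesis using c(1)[OF H(2)] by (auto simp: ray_def)
qed

text \<open>A point inside a segment is the sum of positive multiples of the end points, so
  \<open>ray_summand\<close> places both end points on the ray.\<close>

lemma ray_edge_of:
  fixes w :: "'a::euclidean_space"
  assumes H: "finite H" "h \<in> H" "h \<notin> convex_cone hull (H - {h})"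
    and pos: "\<And>g. g \<in> H \<Longrightarrow> 0 < w \<bullet> g"
  shows "ray h edge_of convex_cone hull H"
proof -
  let ?C = "convex_cone hull H"
  have "ray h face_of ?C"
    unfolding face_of_def
  proof (intro conjI ballI impI)
    show "ray h \<subseteq> ?C" using H(2) by (auto simp: ray_def intro: convex_cone_hull_mul hull_inc)
    show "convex (ray h)" unfolding ray_def
      by (intro convex_linear_image linear_scaleR_left) auto
    have *: "x \<in> ray h \<and> y \<in> ray h"
      if x: "x \<in> ?C" and y: "y \<in> ?C" and z: "z \<in> ray h" and seg: "z \<in> open_segment x y" for x y z
    proof -
      obtain u where u: "0 < u" "u < 1" "z = (1 - u) *\<^sub>R x + u *\<^sub>R y"
        using seg by (auto simp: in_segment)
      have xC: "(1 - u) *\<^sub>R x \<in> ?C" and yC: "u *\<^sub>R y \<in> ?C"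
        using u x y by (auto intro: convex_cone_hull_mul)
      have "(1 - u) *\<^sub>R x \<in> ray h" "u *\<^sub>R y \<in> ray h"
        using ray_summand[OF H pos xC yC] ray_summand[OF H pos yC xC] z u(3) by (simp_all add: add.commute)
      then show ?thesis
        using ray_scaleR[of "1 / (1 - u)" "(1 - u) *\<^sub>R x" h] ray_scaleR[of "1 / u" "u *\<^sub>R y" h] u by simp
    qed
    show "x \<in> ray h" "y \<in> ray h"
      if "x \<in> ?C" "y \<in> ?C" "z \<in> ray h" "z \<in> open_segment x y" for x y z
      using *[OF that] by auto
  qed
  moreover have "aff_dim (ray h) = 1"
  proof -
    have h: "h \<noteq> 0" using pos[OF H(2)] by auto
    have "0 \<in> ray h" "h \<in> ray h"
      by (auto simp: ray_def intro: image_eqI[of _ _ 0] image_eqI[of _ _ 1])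
    moreover have "ray h \<subseteq> span {h}" by (auto simp: ray_def span_base span_scale)
    ultimately have "span (ray h) = span {h}"
      by (meson empty_subsetI insert_subset span_eq span_superset subset_trans)
    then have "dim (ray h) = 1" using h by (metis dim_span dim_singleton)
    then show ?thesis using \<open>0 \<in> ray h\<close> by (simp add: aff_dim_zero hull_inc)
  qed
  ultimately show ?thesis by (simp add: edge_of_def)
qed

text \<open>A generating subset of least cardinality works, since a redundant element could be
  dropped.\<close>

lemma convex_cone_hull_irredundant:
  fixes G :: "'a::real_vector set"
  assumes "finite G"
  obtains H where "H \<subseteq> G" "convex_cone hull H = convex_cone hull G"
    "\<And>h. h \<in> H \<Longrightarrow> h \<notin> convex_cone hull (H - {h})"
proof -
  obtain H where H: "H \<subseteq> G" "convex_cone hull H = convex_cone hull G"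
    and least: "\<And>K. K \<subseteq> G \<and> convex_cone hull K = convex_cone hull G \<Longrightarrow> card H \<le> card K"
    using ex_has_least_nat[of "\<lambda>H. H \<subseteq> G \<and> convex_cone hull H = convex_cone hull G" G card] by auto
  have "h \<notin> convex_cone hull (H - {h})" if "h \<in> H" for h
  proof
    assume "h \<in> convex_cone hull (H - {h})"
    then have "convex_cone hull (H - {h}) = convex_cone hull G"
      using hull_redundant[of h convex_cone "H - {h}"] that H(2) by (simp add: insert_absorb)
    then have "card H \<le> card (H - {h})" using least[of "H - {h}"] H(1) by blast
    moreover have "card (H - {h}) < card H"
      using that H(1) assms by (meson card_Diff1_less finite_subset)
    ultimately show False by simp
  qed
  then show ?thesis using that H by blast
qed

text \<open>The extremal rays spanned by an irredundant generating set are distinct, so if there are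
  no more extremal rays than the dimension, the generating set is a basis.\<close>

lemma simplicial_cone_basis:
  fixes w :: "'a::euclidean_space"
  assumes G: "finite G" "\<And>g. g \<in> G \<Longrightarrow> 0 < w \<bullet> g"
    and dim: "aff_dim (convex_cone hull G) = int DIM('a)"
    and edges: "card {R. R edge_of convex_cone hull G} = DIM('a)"
  obtains H where "H \<subseteq> G" "convex_cone hull H = convex_cone hull G"
    "independent H" "card H = DIM('a)"
    "\<And>h. h \<in> H \<Longrightarrow> h \<notin> convex_cone hull (H - {h})"
proof -
  obtain H where H: "H \<subseteq> G" "convex_cone hull H = convex_cone hull G"
    and irr: "\<And>h. h \<in> H \<Longrightarrow> h \<notin> convex_cone hull (H - {h})"
    using convex_cone_hull_irredundant[OF G(1)] by blast
  have fin: "finite H" using H(1) G(1) finite_subset by blast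
  have "ray ` H \<subseteq> {R. R edge_of convex_cone hull G}"
    using ray_edge_of[OF fin _ irr, of _ w] G(2) H by auto
  \<comment> \<open>An infinite set would have \<open>card\<close> equal to 0, whereas the dimension
    is positive.\<close>
  moreover have "finite {R. R edge_of convex_cone hull G}"
    using edges DIM_positive by (metis card_ge_0_finite)
  ultimately have "card (ray ` H) \<le> DIM('a)" using edges by (metis card_mono)
  moreover have "inj_on ray H"
  proof (rule inj_onI, rule ccontr)
    fix h g assume hg: "h \<in> H" "g \<in> H" "ray h = ray g" "h \<noteq> g"
    have "h \<in> ray h" by (auto simp: ray_def intro: image_eqI[of _ _ 1])
    then obtain t where t: "0 \<le> t" "h = t *\<^sub>R g" using hg(3) by (auto simp: ray_def)
    have "t *\<^sub>R g \<in> convex_cone hull (H - {h})"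
      using t(1) hg(2,4) by (intro convex_cone_hull_mul hull_inc) auto
    then have "h \<in> convex_cone hull (H - {h})" unfolding t(2)[symmetric] .
    then show False using irr hg(1) by blast
  qed
  ultimately have card_le: "card H \<le> DIM('a)" by (simp add: card_image)
  have "convex_cone hull G \<subseteq> span H"
    unfolding H(2)[symmetric] by (intro hull_minimal span_superset convex_cone_span)
  moreover have "dim (convex_cone hull G) = DIM('a)"
    using dim aff_dim_zero[of "convex_cone hull G"]
    by (simp add: hull_inc convex_cone_hull_contains_0)
  then have "span (convex_cone hull G) = UNIV" by (simp add: dim_eq_full)
  ultimately have span: "span H = UNIV" using span_minimal[OF _ subspace_span] by blast
  then have "DIM('a) \<le> card H" using dim_le_card[of UNIV H] fin by (metis dim_UNIV top_greatest)
  then have "card H = DIM('a)" using card_le by simp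
  moreover have "independent H"
    by (rule card_le_dim_spanning[of H UNIV]) (use span fin card_le in auto)
  ultimately show ?thesis using that H irr by blast
qed

subsection \<open>Multiplicities of simplicial semigroups\<close>

lemma real_vec_add: "real_vec (x + y) = real_vec x + real_vec y"
  by (simp add: real_vec_def vec_eq_iff)

lemma real_vec_0 [simp]: "real_vec 0 = 0"
  by (simp add: real_vec_def vec_eq_iff)

lemma real_vec_scale: "real_vec (n *s x) = real n *\<^sub>R real_vec x"
  by (simp add: real_vec_def vec_eq_iff)

lemma real_vec_sum: "real_vec (\<Sum>i\<in>I. f i) = (\<Sum>i\<in>I. real_vec (f i))"
  by (induction I rule: infinite_finite_induct) (simp_all add: real_vec_add)

lemma inner_1_real_vec: "1 \<bullet> real_vec x = real (vec_size x)"
  by (simp add: inner_vec_def real_vec_def vec_size_def)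

text \<open>Links the cone over \<open>S\<close> in \<open>simplicial\<close> to the finitely
  generated cone over \<open>msg S\<close> in \<open>cone_points\<close>.\<close>

lemma real_cone_irreducibles:
  assumes "add_submonoid S"
  shows "real_cone S = convex_cone hull (real_vec ` irreducibles S)"
proof
  let ?C = "convex_cone hull (real_vec ` irreducibles S)"
  have "real_vec s \<in> ?C" if "s \<in> add_submonoid hull (irreducibles S)" for s
    using that
    by (rule hull_induct)
      (auto simp: add_submonoid_def real_vec_add convex_cone_hull_contains_0
        intro: hull_inc convex_cone_hull_add)
  then show "real_cone S \<subseteq> ?C"
    using hull_irreducibles[OF assms] unfolding real_cone_def
    by (intro hull_minimal convex_cone_convex_cone_hull) auto
  show "?C \<subseteq> real_cone S"
    unfolding real_cone_def by (intro hull_mono image_mono) (auto simp: irreducibles_def)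
qed

lemma real_vec_in_real_cone: "s \<in> S \<Longrightarrow> real_vec s \<in> real_cone S"
  by (auto simp: real_cone_def intro: hull_inc)

lemma cone_points_eq:
  assumes "affine_semigroup S"
  shows "cone_points S = {x. real_vec x \<in> real_cone S}"
  using real_cone_irreducibles[OF affine_semigroup_submonoid[OF assms]] msg_eq_irreducibles[OF assms]
  by (simp add: cone_points_def real_cone_def)

text \<open>A sum \<open>y + z\<close> of nonzero elements lies strictly above \<open>y\<close> in
  the cone order, because \<open>z\<close> belongs to the cone.\<close>

lemma Mult_subset_irreducibles:
  assumes "affine_semigroup S"
  shows "Mult S \<subseteq> irreducibles S"
proof -
  have "y + z \<notin> Mult S" if "y \<in> S - {0}" "z \<in> S - {0}" for y z
  proof
    assume "y + z \<in> Mult S"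
    moreover have "cone_le S y (y + z)"
      using that real_vec_in_real_cone[of z S] by (auto simp: cone_le_def diff_in_def cone_points_eq[OF assms])
    ultimately have "y = y + z" using that(1) by (auto simp: Mult_def)
    then have "z = 0" by (metis add_cancel_right_right)
    then show False using that(2) by simp
  qed
  then show ?thesis by (auto simp: irreducibles_def Mult_def)
qed

text \<open>On every extremal ray, the shortest nonzero element of the semigroup is a multiplicity. A
  simplicial semigroup with \<open>p\<close> multiplicities thus has exactly one on each ray, and the functionals
  below are the corresponding dual basis.\<close>

lemma simplicial_Mult_functional:
  fixes S :: "(nat ^ 'p) set"
  assumes S: "affine_semigroup S" "simplicial S"
    and card: "card (Mult S) = CARD('p)" and x: "x \<in> Mult S"
  obtains \<phi> :: "real ^ 'p \<Rightarrow> real" where "linear \<phi>" "0 < \<phi> (real_vec x)"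
    "\<And>y. y \<in> Mult S \<Longrightarrow> y \<noteq> x \<Longrightarrow> \<phi> (real_vec y) = 0"
    "\<And>s. s \<in> S \<Longrightarrow> 0 \<le> \<phi> (real_vec s)"
proof -
  let ?G = "real_vec ` irreducibles S" let ?C = "convex_cone hull ?G"
  have C: "real_cone S = ?C" by (intro real_cone_irreducibles affine_semigroup_submonoid S)
  have pos: "0 < 1 \<bullet> g" if g: "g \<in> ?G" for g
  proof -
    obtain x where x: "g = real_vec x" "x \<in> irreducibles S" using g by blast
    then show ?thesis by (auto simp: irreducibles_def inner_1_real_vec)
  qed
  obtain H where H: "H \<subseteq> ?G" "convex_cone hull H = ?C" "independent H" "card H = CARD('p)"
    and irr: "\<And>h. h \<in> H \<Longrightarrow> h \<notin> convex_cone hull (H - {h})"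
    by (rule simplicial_cone_basis[of ?G 1]) (use pos S finite_irreducibles[OF S(1)] C in \<open>auto simp: simplicial_def\<close>)
  have fin: "finite H" using H(3) by (rule independent_imp_finite)
  have "\<exists>m\<in>Mult S. \<exists>c>0. real_vec m = c *\<^sub>R h" if h: "h \<in> H" for h
  proof -
    obtain h0 where h0: "h0 \<in> irreducibles S" "h = real_vec h0" using H(1) h by blast
    have "h \<in> ray h" by (auto simp: ray_def intro: image_eqI[of _ _ 1])
    then have "h0 \<in> S - {0} \<and> real_vec h0 \<in> ray h" using h0 by (auto simp: irreducibles_def)
    then obtain m where m: "m \<in> S - {0}" "real_vec m \<in> ray h"
      and least: "\<And>y. y \<in> S - {0} \<and> real_vec y \<in> ray h \<Longrightarrow> vec_size m \<le> vec_size y"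
      using ex_has_least_nat[of "\<lambda>m. m \<in> S - {0} \<and> real_vec m \<in> ray h" h0 vec_size] by blast
    \<comment> \<open>Extremality forces an element below \<open>m\<close> onto the same ray; there
      it cannot be shorter than \<open>m\<close>, so the difference \<open>z\<close> is 0.\<close>
    have "y = m" if y: "y \<in> S - {0}" "cone_le S y m" for y
    proof -
      obtain z where z: "m = y + z" "real_vec z \<in> ?C"
        using y(2) by (auto simp: cone_le_def diff_in_def cone_points_eq[OF S(1)] C)
      have "real_vec y \<in> ?C" using y(1) real_vec_in_real_cone[of y S] C by auto
      then have "real_vec y \<in> ray h"
        using ray_summand[OF fin h irr[OF h], of 1 "real_vec y" "real_vec z"] z m(2) H pos
        by (auto simp: real_vec_add)
      then have "vec_size m \<le> vec_size y" using least y(1) by blast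
      then show ?thesis by (simp add: z(1))
    qed
    then have "m \<in> Mult S" using m(1) by (auto simp: Mult_def)
    moreover obtain c where c: "0 \<le> c" "real_vec m = c *\<^sub>R h" using m(2) by (auto simp: ray_def)
    moreover have "c \<noteq> 0"
    proof
      assume "c = 0"
      then have "vec_size m = 0" using c(2) inner_1_real_vec[of m] by simp
      then show False using m(1) by simp
    qed
    ultimately show ?thesis by (intro bexI[of _ m] exI[of _ c]) auto
  qed
  then obtain f c where f: "\<And>h. h \<in> H \<Longrightarrow> f h \<in> Mult S" "\<And>h. h \<in> H \<Longrightarrow> 0 < c h"
    "\<And>h. h \<in> H \<Longrightarrow> real_vec (f h) = c h *\<^sub>R h"
    by metis
  have "inj_on f H"
  proof (rule inj_onI, rule ccontr)
    fix h g assume hg: "h \<in> H" "g \<in> H" "f h = f g" "h \<noteq> g"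
    then have "c h *\<^sub>R h = c g *\<^sub>R g" using f(3)[of h] f(3)[of g] by simp
    then have "(1 / c h) *\<^sub>R (c h *\<^sub>R h) = (1 / c h) *\<^sub>R (c g *\<^sub>R g)" by simp
    then have "h = (c g / c h) *\<^sub>R g" using f(2)[OF hg(1)] by simp
    moreover have "(c g / c h) *\<^sub>R g \<in> convex_cone hull (H - {h})"
      using hg f(2) by (intro convex_cone_hull_mul hull_inc) (auto simp: less_imp_le)
    ultimately show False using irr[OF hg(1)] by simp
  qed
  \<comment> \<open>Both sets have as many elements as the dimension, so the rays already account
    for every multiplicity.\<close>
  then have "card (f ` H) = card (Mult S)" using H(4) card by (simp add: card_image)
  moreover have "finite (Mult S)" using Mult_subset_irreducibles finite_irreducibles S(1) finite_subset by metis
  ultimately have surj: "f ` H = Mult S" using f(1) by (intro card_subset_eq) auto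
  then obtain h where h: "h \<in> H" "x = f h" using x by blast
  \<comment> \<open>The coordinate of the basis \<open>H\<close> belonging to \<open>h\<close>. It
    is non-negative on \<open>S\<close>, whose points are non-negative combinations of
    \<open>H\<close>.\<close>
  obtain \<phi> :: "real ^ 'p \<Rightarrow> real" where \<phi>: "linear \<phi>" "\<forall>g\<in>H. \<phi> g = (if g = h then 1 else 0)"
    using linear_independent_extend[OF H(3), of "\<lambda>g. if g = h then 1 else 0 :: real"] by blast
  show ?thesis
  proof (rule that[OF \<phi>(1)])
    show "0 < \<phi> (real_vec x)"
      using h f(2,3) \<phi> by (simp add: linear_scale)
    show "\<phi> (real_vec y) = 0" if y: "y \<in> Mult S" "y \<noteq> x" for y
    proof -
      obtain g where "g \<in> H" "y = f g" using surj y(1) by blast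
      then show ?thesis using y(2) h f(3) \<phi> by (auto simp: linear_scale)
    qed
    show "0 \<le> \<phi> (real_vec s)" if "s \<in> S" for s
    proof -
      have "real_vec s \<in> convex_cone hull H" using real_vec_in_real_cone[OF that] C H(2) by simp
      then obtain d where "\<forall>g\<in>H. 0 \<le> d g" "real_vec s = (\<Sum>g\<in>H. d g *\<^sub>R g)"
        using convex_cone_hull_finite[OF fin] by blast
      then show ?thesis
        using \<phi> by (auto simp: linear_sum linear_scale intro!: sum_nonneg)
    qed
  qed
qed

subsection \<open>Monomials of a strong simplicial semigroup\<close>

declare One_nat_def [simp del]

lemma single_eq_0_iff [simp]: "Poly_Mapping.single x n = 0 \<longleftrightarrow> n = 0"
  by (metis lookup_single_eq lookup_zero single_zero)

lemma S_degree_single_Inl [simp]: "S_degree e a (Poly_Mapping.single (Inl i) n) = n *s e i"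
proof -
  have "Poly_Mapping.lookup (Poly_Mapping.single (Inl i) n) (Inl k) *s e k
      = (if k = i then n *s e i else 0)" for k
    by (simp add: lookup_single when_def)
  then show ?thesis by (simp add: S_degree_def lookup_single)
qed

lemma S_degree_single_Inr [simp]: "S_degree e a (Poly_Mapping.single (Inr j) n) = n *s a j"
proof -
  have "Poly_Mapping.lookup (Poly_Mapping.single (Inr j) n) (Inr k) *s a k
      = (if k = j then n *s a j else 0)" for k
    by (simp add: lookup_single when_def)
  then show ?thesis by (simp add: S_degree_def lookup_single)
qed

definition x_monomial :: "nat ^ 't \<Rightarrow> ('t::finite, 'r::finite) mon" where
  "x_monomial \<omega> = Abs_poly_mapping (case_sum (($) \<omega>) (\<lambda>_. 0))"

lemma lookup_x_monomial [simp]: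
  "Poly_Mapping.lookup (x_monomial \<omega>) (Inl i) = \<omega> $ i"
  "Poly_Mapping.lookup (x_monomial \<omega>) (Inr j) = 0"
  by (simp_all add: x_monomial_def)

lemma S_degree_x_monomial [simp]: "S_degree e a (x_monomial \<omega>) = (\<Sum>i\<in>UNIV. \<omega> $ i *s e i)"
  by (simp add: S_degree_def)

lemma mon_eqI:
  fixes u v :: "('t, 'r) mon"
  assumes "\<And>i. Poly_Mapping.lookup u (Inl i) = Poly_Mapping.lookup v (Inl i)"
    and "\<And>j. Poly_Mapping.lookup u (Inr j) = Poly_Mapping.lookup v (Inr j)"
  shows "u = v"
proof (rule poly_mapping_eqI)
  show "Poly_Mapping.lookup u x = Poly_Mapping.lookup v x" for x
    by (cases x) (simp_all add: assms)
qed

lemma x_monomial_0 [simp]: "x_monomial 0 = 0"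
  by (rule mon_eqI) simp_all

lemma pm_single_dvd:
  fixes u :: "'i \<Rightarrow>\<^sub>0 nat"
  assumes "n \<le> Poly_Mapping.lookup u x"
  obtains w where "u = Poly_Mapping.single x n + w"
  using pm_diff_add[of "Poly_Mapping.single x n" u] assms
  by (metis le0 lookup_single_eq lookup_single_not_eq)

lemma pm_nonzero_dvd:
  fixes u :: "'i \<Rightarrow>\<^sub>0 nat"
  assumes "u \<noteq> 0"
  obtains x w where "u = Poly_Mapping.single x 1 + w"
proof -
  obtain x where "Poly_Mapping.lookup u x \<noteq> 0" using assms by (metis lookup_zero poly_mapping_eqI)
  then have "1 \<le> Poly_Mapping.lookup u x" by simp
  then show ?thesis using that pm_single_dvd by metis
qed

lemma mon_size_single [simp]: "mon_size (Poly_Mapping.single x n) = n"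
proof -
  have "Poly_Mapping.lookup (Poly_Mapping.single x n) y = (if y = x then n else 0)" for y
    by (simp add: lookup_single when_def)
  then show ?thesis by (simp add: mon_size_def)
qed

text \<open>The variables correspond bijectively to the irreducibles of \<open>S\<close>. The
  assumption \<open>functional\<close> is the form in which simpliciality and the number of
  multiplicities enter.\<close>

locale strong_simplicial =
  fixes S :: "(nat ^ 'p) set" and e :: "'t::finite \<Rightarrow> nat ^ 'p" and a :: "'r::finite \<Rightarrow> nat ^ 'p"
  assumes submonoid: "add_submonoid S"
    and inj_gen: "inj (case_sum e a)"
    and range_gen: "range (case_sum e a) = irreducibles S"
    and strong: "\<And>x y. x \<in> S \<Longrightarrow> y \<in> S \<Longrightarrow> x \<noteq> 0 \<Longrightarrow> y \<noteq> 0 \<Longrightarrow> x \<noteq> y \<Longrightarrow> \<exists>i. diff_in (x + y) (e i) S"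
    and functional: "\<And>i. \<exists>\<phi> :: real ^ 'p \<Rightarrow> real. linear \<phi> \<and> 0 < \<phi> (real_vec (e i)) \<and>
      (\<forall>k. k \<noteq> i \<longrightarrow> \<phi> (real_vec (e k)) = 0) \<and> (\<forall>s\<in>S. 0 \<le> \<phi> (real_vec s))"
begin

section \<open>Degrees, fibres and Apery elements in terms of monomials\<close>

abbreviation deg :: "('t, 'r) mon \<Rightarrow> nat ^ 'p" where "deg \<equiv> S_degree e a"
abbreviation var :: "'t + 'r \<Rightarrow> ('t, 'r) mon" where "var x \<equiv> Poly_Mapping.single x 1"
abbreviation y_power :: "'r \<Rightarrow> nat \<Rightarrow> ('t, 'r) mon" where
  "y_power j n \<equiv> Poly_Mapping.single (Inr j) n"

lemma deg_var: "deg (var x) = case_sum e a x"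
  by (cases x) simp_all

lemma deg_var_irreducible: "deg (var x) \<in> irreducibles S"
  using range_gen deg_var by (metis rangeI)

lemma deg_in_S: "deg u \<in> S"
proof (induction "mon_size u" arbitrary: u rule: less_induct)
  case less
  show ?case
  proof (cases "u = 0")
    case True
    then show ?thesis using submonoid by (simp add: add_submonoid_def)
  next
    case False
    then obtain x w where u: "u = var x + w" by (rule pm_nonzero_dvd)
    have "mon_size (var x) \<noteq> 0" by simp
    then have "deg w \<in> S" by (intro less) (simp add: u)
    moreover have "deg (var x) \<in> S" using deg_var_irreducible[of x] by (simp add: irreducibles_def)
    ultimately show ?thesis using submonoid by (simp add: u S_degree_add add_submonoid_def)
  qed
qed

lemma in_S_deg:
  assumes "s \<in> S"
  obtains u where "s = deg u"
proof -
  have "s \<in> add_submonoid hull (irreducibles S)" using assms hull_irreducibles[OF submonoid] by simp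
  moreover have "irreducibles S \<subseteq> range deg"
    by (auto simp: deg_var[symmetric] simp flip: range_gen)
  moreover have "add_submonoid (range deg)"
    unfolding add_submonoid_def by (auto intro: image_eqI[of _ _ 0] simp flip: S_degree_add)
  ultimately have "s \<in> range deg"
    using hull_minimal[of "irreducibles S" "range deg" add_submonoid] by blast
  then show ?thesis using that by blast
qed

lemma deg_eq_0D:
  assumes "deg u = 0"
  shows "u = 0"
proof (rule ccontr)
  assume "u \<noteq> 0"
  then obtain x w where "u = var x + w" by (rule pm_nonzero_dvd)
  then have "deg (var x) + deg w = 0" using assms by (simp add: S_degree_add)
  then have "deg (var x) = 0" by (simp add: vec_eq_iff)
  then show False using deg_var_irreducible[of x] by (simp add: irreducibles_def)
qed

lemma nonunique_0: "\<not> nonunique e a 0"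
  using deg_eq_0D by (auto simp: nonunique_def)

text \<open>An irreducible degree only admits single variables, and distinct variables have distinct
  degrees.\<close>

lemma nonunique_var: "\<not> nonunique e a (var x)"
proof
  assume "nonunique e a (var x)"
  then obtain v where v: "v \<noteq> var x" "deg v = deg (var x)" by (auto simp: nonunique_def)
  then have "v \<noteq> 0" using deg_var_irreducible[of x] by (auto simp: irreducibles_def)
  then obtain y w where w: "v = var y + w" by (rule pm_nonzero_dvd)
  have nz: "deg (var y) \<noteq> 0" using deg_var_irreducible[of y] by (simp add: irreducibles_def)
  have "deg (var x) = deg (var y) + deg w" using v(2) w by (simp add: S_degree_add)
  then have "deg w = 0"
    using deg_var_irreducible[of x] nz deg_in_S[of w] deg_in_S[of "var y"]
    unfolding irreducibles_def by blast
  then have "w = 0" by (rule deg_eq_0D)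
  then have "case_sum e a y = case_sum e a x" using v(2) w by (simp add: deg_var)
  then show False using v(1) w \<open>w = 0\<close> inj_gen by (simp add: inj_eq)
qed

lemma mon_size_le_1_unique:
  assumes "mon_size u \<le> 1"
  shows "\<not> nonunique e a u"
proof (cases "u = 0")
  case True
  then show ?thesis using nonunique_0 by simp
next
  case False
  then obtain x w where u: "u = var x + w" by (rule pm_nonzero_dvd)
  have "mon_size (var x) \<noteq> 0" by simp
  then have "mon_size w = 0" using assms u by simp
  then show ?thesis using u nonunique_var by simp
qed

text \<open>If one monomial of a fibre divides another, the quotient has degree 0 and is trivial; so
  a fibre is an antichain.\<close>

lemma finite_fibre: "finite (fibre e a m)"
proof -
  have "finite (Poly_Mapping.lookup ` fibre e a m)"
  proof (rule finite_antichain_nat_functions)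
    fix f g assume "f \<in> Poly_Mapping.lookup ` fibre e a m" "g \<in> Poly_Mapping.lookup ` fibre e a m" "f \<le> g"
    then obtain u v where uv: "f = Poly_Mapping.lookup u" "g = Poly_Mapping.lookup v" "deg u = deg v"
      by (auto simp: fibre_def)
    then have v: "v = u + (v - u)" using \<open>f \<le> g\<close> by (intro pm_diff_add) (simp add: le_fun_def)
    then have "deg u + deg (v - u) = deg u + 0" using uv(3) by (metis S_degree_add add.right_neutral)
    then have "v - u = 0" using deg_eq_0D by (metis add_left_cancel)
    then show "f = g" using uv v by simp
  qed
  then show ?thesis by (rule finite_imageD) (simp add: inj_on_def lookup_inject)
qed

text \<open>Translates the cardinality conditions of \<open>T_set\<close> and \<open>T'_set\<close>;
  finiteness of the fibres keeps \<open>card\<close> from defaulting to 0.\<close>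

lemma
  shows card_fibre_ge_2: "card (fibre e a (deg u)) \<ge> 2 \<longleftrightarrow> nonunique e a u"
    and card_fibre_eq_1: "card (fibre e a (deg u)) = 1 \<longleftrightarrow> \<not> nonunique e a u"
proof -
  let ?F = "fibre e a (deg u)"
  have u: "u \<in> ?F" by (simp add: fibre_def)
  have "card ?F > 0" using u finite_fibre by (auto simp: card_gt_0_iff)
  moreover have "card ?F = 1 \<longleftrightarrow> ?F = {u}" using u by (auto elim!: card_1_singletonE)
  moreover have "?F = {u} \<longleftrightarrow> \<not> nonunique e a u" using u by (auto simp: nonunique_def fibre_def)
  ultimately show "card ?F \<ge> 2 \<longleftrightarrow> nonunique e a u" "card ?F = 1 \<longleftrightarrow> \<not> nonunique e a u"
    by linarith+
qed

lemma Ap_iff: "deg u \<in> Ap S (range e) \<longleftrightarrow> (\<nexists>i w. deg u = deg (var (Inl i) + w))"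
proof -
  have "diff_in (deg u) (e i) S \<longleftrightarrow> (\<exists>w. deg u = deg (var (Inl i) + w))" for i
    unfolding diff_in_def by (auto simp: S_degree_add deg_in_S elim: in_S_deg)
  then show ?thesis by (auto simp: Ap_def deg_in_S)
qed

lemma strong_mon:
  assumes "u \<noteq> 0" "v \<noteq> 0" "deg u \<noteq> deg v"
  obtains i w where "deg (u + v) = deg (var (Inl i) + w)"
proof -
  have "deg (u + v) \<notin> Ap S (range e)"
    using strong[OF deg_in_S deg_in_S, of u v] assms deg_eq_0D by (auto simp: Ap_def S_degree_add)
  then show ?thesis using that Ap_iff by blast
qed

section \<open>Exchangeable monomials in the \<open>y\<close>-variables\<close>

inductive pure_y :: "('t, 'r) mon \<Rightarrow> bool" where
  mixed: "j \<noteq> k \<Longrightarrow> pure_y (y_power j 1 + y_power k 1)"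
| square: "2 *s a j \<notin> Ap S (range e) \<Longrightarrow> pure_y (y_power j 2)"
| cube: "2 *s a j \<in> Ap S (range e) \<Longrightarrow> pure_y (y_power j 3)"

lemma lookup_pure_y: "pure_y q \<Longrightarrow> Poly_Mapping.lookup q (Inl i) = 0"
  by (induction rule: pure_y.induct) (simp_all add: lookup_add lookup_single)

lemma a_eq_iff: "a j = a k \<longleftrightarrow> j = k"
  using inj_eq[OF inj_gen, of "Inr j" "Inr k"] by simp

text \<open>Strongness applies to the distinct elements \<open>a j\<close> and \<open>a k\<close> in
  the mixed case, and to \<open>a j\<close> and \<open>2 *s a j\<close> for a cube. For a square the
  exchange is the failure of the Apery condition.\<close>

lemma pure_y_exchange:
  assumes "pure_y q"
  obtains i w where "deg q = deg (var (Inl i) + w)"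
  using assms
proof cases
  case (mixed j k)
  have "y_power j 1 \<noteq> 0" "y_power k 1 \<noteq> 0" by simp_all
  moreover have "deg (y_power j 1) \<noteq> deg (y_power k 1)" using mixed(2) by (simp add: a_eq_iff)
  ultimately show ?thesis using strong_mon mixed(1) that by metis
next
  case (square j)
  then have "deg q \<notin> Ap S (range e)" by simp
  then show ?thesis using that Ap_iff by blast
next
  case (cube j)
  have q: "q = y_power j 1 + y_power j 2" by (simp add: cube(1) flip: single_add)
  have nz: "y_power j 1 \<noteq> 0" "y_power j 2 \<noteq> 0" by simp_all
  have "deg (y_power j 1) \<noteq> deg (y_power j 2)"
  proof
    assume "deg (y_power j 1) = deg (y_power j 2)"
    then have "a j = 2 *s a j" by simp
    then have "a j = 0" by (simp add: vec_eq_iff)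
    then have "deg (y_power j 1) = 0" by simp
    then show False using deg_eq_0D nz(1) by blast
  qed
  then show ?thesis using strong_mon[OF nz] q that by metis
qed

text \<open>Two different \<open>y\<close>-variables give a mixed divisor. With a single one, the
  Apery condition on \<open>2 *s a j\<close> decides whether exponents from 2 or only from 3 on give
  a \<open>pure_y\<close> divisor.\<close>

lemma mon_classification:
  defines "\<omega> \<equiv> (\<lambda>u. \<chi> i. Poly_Mapping.lookup u (Inl i))"
  obtains (divisible) q w where "pure_y q" "u = q + w"
  | (none) "u = x_monomial (\<omega> u)"
  | (linear) j where "u = x_monomial (\<omega> u) + y_power j 1"
  | (square) j where "2 *s a j \<in> Ap S (range e)" "u = x_monomial (\<omega> u) + y_power j 2"
proof -
  consider (zero) "\<And>j. Poly_Mapping.lookup u (Inr j) = 0"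
    | (two) j k where "j \<noteq> k" "Poly_Mapping.lookup u (Inr j) \<noteq> 0" "Poly_Mapping.lookup u (Inr k) \<noteq> 0"
    | (one) j where "Poly_Mapping.lookup u (Inr j) \<noteq> 0" "\<And>k. k \<noteq> j \<Longrightarrow> Poly_Mapping.lookup u (Inr k) = 0"
    by metis
  then show thesis
  proof cases
    case zero
    then have "u = x_monomial (\<omega> u)" by (intro mon_eqI) (simp_all add: \<omega>_def)
    then show ?thesis by (rule none)
  next
    case two
    have "u = (y_power j 1 + y_power k 1) + (u - (y_power j 1 + y_power k 1))"
    proof (rule pm_diff_add)
      show "Poly_Mapping.lookup (y_power j 1 + y_power k 1) x \<le> Poly_Mapping.lookup u x" for x
        using two by (cases x) (auto simp: lookup_add lookup_single when_def)
    qed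
    then show ?thesis using divisible pure_y.mixed[OF two(1)] by blast
  next
    case one
    define n where "n = Poly_Mapping.lookup u (Inr j)"
    have u: "u = x_monomial (\<omega> u) + y_power j n"
    proof (rule mon_eqI)
      show "Poly_Mapping.lookup u (Inr k) = Poly_Mapping.lookup (x_monomial (\<omega> u) + y_power j n) (Inr k)" for k
        using one(2)[of k] by (cases "k = j") (auto simp: lookup_add lookup_single n_def)
    qed (simp add: \<omega>_def lookup_add lookup_single)
    have split: "u = y_power j m + (x_monomial (\<omega> u) + y_power j (n - m))" if "m \<le> n" for m
    proof -
      have "y_power j n = y_power j m + y_power j (n - m)" using that by (simp flip: single_add)
      then show ?thesis using u by (metis add.left_commute)
    qed
    have "n \<noteq> 0" using one(1) by (simp add: n_def)
    then consider "n = 1" | "n = 2" | "n \<ge> 3" by linarith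
    then show ?thesis
    proof cases
      case 1
      then show ?thesis using linear u by metis
    next
      case 2
      show ?thesis
      proof (cases "2 *s a j \<in> Ap S (range e)")
        case True
        then show ?thesis using square u 2 by metis
      next
        case False
        then show ?thesis using divisible[OF pure_y.square split] 2 by simp
      qed
    next
      case 3
      show ?thesis
      proof (cases "2 *s a j \<in> Ap S (range e)")
        case True
        then show ?thesis using divisible[OF pure_y.cube split] 3 by simp
      next
        case False
        then show ?thesis using divisible[OF pure_y.square split] 3 by simp
      qed
    qed
  qed
qed

text \<open>Another monomial of this degree has neither an \<open>x\<close>-variable nor a
  \<open>pure_y\<close> divisor, since either would allow some \<open>e i\<close> to be subtracted.
  The classification leaves 1, a variable, or a square \<open>y_power k 2\<close>, whose degree
  forces \<open>k = j\<close>.\<close>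

lemma square_unique:
  assumes "2 *s a j \<in> Ap S (range e)"
  shows "\<not> nonunique e a (y_power j 2)"
proof
  assume "nonunique e a (y_power j 2)"
  then obtain v where v: "v \<noteq> y_power j 2" "deg v = 2 *s a j" by (auto simp: nonunique_def)
  then have nonunique: "nonunique e a v" by (auto simp: nonunique_def)
  have no_x: "deg v \<noteq> deg (var (Inl i) + w)" for i w
    using assms Ap_iff[of v] v(2) by auto
  have "Poly_Mapping.lookup v (Inl i) = 0" for i
    using pm_single_dvd[of 1 v "Inl i"] no_x by (metis less_one not_le)
  then have \<omega>: "(\<chi> i. Poly_Mapping.lookup v (Inl i)) = 0" by (simp add: vec_eq_iff)
  show False
  proof (cases rule: mon_classification[of v])
    case (divisible q w)
    then obtain i w' where "deg q = deg (var (Inl i) + w')" using pure_y_exchange by metis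
    then have "deg v = deg (var (Inl i) + (w' + w))" using divisible(2) by (simp add: S_degree_add add.assoc)
    then show False using no_x by blast
  next
    case none
    then show False using \<omega> nonunique nonunique_0 by simp
  next
    case (linear k)
    then have "v = var (Inr k)" using \<omega> by simp
    then show False using nonunique nonunique_var by blast
  next
    case (square k)
    then have vk: "v = y_power k 2" using \<omega> by simp
    then have "2 *s a k = 2 *s a j" using v(2) by simp
    then have "a k = a j" by (simp add: vec_eq_iff)
    then show False using vk v(1) by (simp add: a_eq_iff)
  qed
qed

lemma pure_y_nonunique:
  assumes "pure_y q"
  shows "nonunique e a q"
proof -
  obtain i w where w: "deg q = deg (var (Inl i) + w)" using pure_y_exchange[OF assms] .
  have "Poly_Mapping.lookup (var (Inl i) + w) (Inl i) \<noteq> 0" by (simp add: lookup_add)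
  then have "q \<noteq> var (Inl i) + w" using lookup_pure_y[OF assms] by metis
  then show ?thesis using w by (auto simp: nonunique_def)
qed

text \<open>Proper divisors of a monomial of size 2 have size at most 1 and are unique. For a cube
  the only further proper divisor is the square, which is unique by
  \<open>square_unique\<close>.\<close>

lemma pure_y_min_nonunique:
  assumes "pure_y q"
  shows "min_nonunique e a q"
proof -
  have small: "w = 0" if "mon_size q = 2" "q = v + w" "nonunique e a v" for v w
    using that mon_size_le_1_unique[of v] mon_size_eq_0[of w] by fastforce
  have "w = 0" if vw: "q = v + w" "nonunique e a v" for v w
    using assms
  proof cases
    case (mixed j k)
    then show ?thesis using small[OF _ vw] by simp
  next
    case (square j)
    then show ?thesis using small[OF _ vw] by simp
  next
    case (cube j)
    define n where "n = Poly_Mapping.lookup v (Inr j)"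
    have sum: "Poly_Mapping.lookup v x + Poly_Mapping.lookup w x = Poly_Mapping.lookup (y_power j 3) x" for x
      using vw(1) cube(1) by (metis lookup_add)
    have v: "v = y_power j n"
    proof (rule poly_mapping_eqI)
      show "Poly_Mapping.lookup v x = Poly_Mapping.lookup (y_power j n) x" for x
        using sum[of x] by (cases "x = Inr j") (auto simp: lookup_single n_def)
    qed
    have "n \<noteq> 2" using square_unique[OF cube(2)] vw(2) v by auto
    moreover have "\<not> n \<le> 1" using mon_size_le_1_unique[of v] vw(2) v by auto
    moreover have "n + mon_size w = 3" using arg_cong[OF vw(1), of mon_size] cube(1) v by simp
    ultimately have "mon_size w = 0" by linarith
    then show ?thesis by simp
  qed
  then show ?thesis using pure_y_nonunique[OF assms] by (auto simp: min_nonunique_def)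
qed

section \<open>Minimal monomials with one \<open>y\<close>-variable and the sets
  \<open>T_set\<close>, \<open>T'_set\<close>\<close>

definition exponents :: "'r \<Rightarrow> nat \<Rightarrow> (nat ^ 't) set" where
  "exponents j n = {\<alpha>. nonunique e a (x_monomial \<alpha> + y_power j (Suc n)) \<and>
     \<not> nonunique e a (x_monomial \<alpha> + y_power j n)}"

lemma card_fibre_x_monomial:
  "card (fibre e a ((\<Sum>i\<in>UNIV. \<alpha> $ i *s e i) + n *s a j)) \<ge> 2
     \<longleftrightarrow> nonunique e a (x_monomial \<alpha> + y_power j n)"
  "card (fibre e a ((\<Sum>i\<in>UNIV. \<alpha> $ i *s e i) + n *s a j)) = 1
     \<longleftrightarrow> \<not> nonunique e a (x_monomial \<alpha> + y_power j n)"
  using card_fibre_ge_2[of "x_monomial \<alpha> + y_power j n"]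
    card_fibre_eq_1[of "x_monomial \<alpha> + y_power j n"]
  by (simp_all add: S_degree_add)

lemma T_set_eq: "T_set e a j = exponents j 0"
  using card_fibre_x_monomial(1)[of _ 1 j] card_fibre_x_monomial(2)[of _ 0 j]
  by (simp add: T_set_def exponents_def flip: One_nat_def)

lemma T'_set_eq: "T'_set e a j = exponents j 1"
  using card_fibre_x_monomial(1)[of _ 2 j] card_fibre_x_monomial(2)[of _ 1 j]
  by (simp add: T'_set_def exponents_def Suc_1)

lemma x_monomial_le:
  assumes "\<alpha> \<le> \<omega>"
  shows "x_monomial \<omega> = (x_monomial \<alpha> + x_monomial (\<omega> - \<alpha>) :: ('t, 'r) mon)"
  using assms by (intro mon_eqI) (simp_all add: lookup_add less_eq_vec_def)

text \<open>Treats both sets at once. In a minimal monomial, dropping one \<open>y\<close>-factor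
  must give a unique monomial, and lowering \<omega> inside \<open>exponents j n\<close> would give
  a proper nonunique divisor. Conversely, a nonunique divisor must carry the full exponent
  \<open>Suc n\<close>, as all divisors of the unique monomial with exponent \<open>n\<close> are
  unique; minimality of \<omega> then fixes its \<open>x\<close>-part.\<close>

lemma min_nonunique_iff_Hilb:
  "min_nonunique e a (x_monomial \<omega> + y_power j (Suc n)) \<longleftrightarrow> \<omega> \<in> Hilb (exponents j n)"
proof
  let ?u = "x_monomial \<omega> + y_power j (Suc n)"
  assume min: "min_nonunique e a ?u"
  have "y_power j (Suc n) = y_power j n + y_power j 1"
    by (metis Suc_eq_plus1 single_add)
  then have "?u = (x_monomial \<omega> + y_power j n) + y_power j 1"
    by (simp add: add.assoc)
  moreover have "y_power j 1 \<noteq> 0" by simp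
  ultimately have "\<not> nonunique e a (x_monomial \<omega> + y_power j n)"
    using min unfolding min_nonunique_def by blast
  then have "\<omega> \<in> exponents j n" using min by (simp add: exponents_def min_nonunique_def)
  moreover have "\<alpha> = \<omega>" if \<alpha>: "\<alpha> \<in> exponents j n" "\<alpha> \<le> \<omega>" for \<alpha>
  proof -
    have "?u = (x_monomial \<alpha> + y_power j (Suc n)) + x_monomial (\<omega> - \<alpha>)"
      using x_monomial_le[OF \<alpha>(2)] by (simp add: ac_simps)
    then have "x_monomial (\<omega> - \<alpha>) = (0 :: ('t, 'r) mon)"
      using min \<alpha>(1) by (auto simp: min_nonunique_def exponents_def)
    then have "x_monomial \<omega> = (x_monomial \<alpha> :: ('t, 'r) mon)" using x_monomial_le[OF \<alpha>(2)] by simp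
    then show ?thesis by (metis lookup_x_monomial(1) vec_eq_iff)
  qed
  ultimately show "\<omega> \<in> Hilb (exponents j n)" by (auto simp: Hilb_def)
next
  let ?u = "x_monomial \<omega> + y_power j (Suc n)"
  assume \<omega>: "\<omega> \<in> Hilb (exponents j n)"
  then have "nonunique e a ?u" by (simp add: Hilb_def exponents_def)
  moreover have "w = 0" if vw: "?u = v + w" "nonunique e a v" for v w
  proof -
    define \<alpha> m where "\<alpha> = (\<chi> i. Poly_Mapping.lookup v (Inl i))" and "m = Poly_Mapping.lookup v (Inr j)"
    have sum: "Poly_Mapping.lookup v x + Poly_Mapping.lookup w x = Poly_Mapping.lookup ?u x" for x
      using vw(1) by (metis lookup_add)
    have le: "\<alpha> \<le> \<omega>"
      unfolding less_eq_vec_def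
    proof
      show "\<alpha> $ i \<le> \<omega> $ i" for i
        using sum[of "Inl i"] by (simp add: \<alpha>_def lookup_add lookup_single)
    qed
    have m: "m \<le> Suc n" using sum[of "Inr j"] by (simp add: m_def lookup_add)
    have v: "v = x_monomial \<alpha> + y_power j m"
    proof (rule mon_eqI)
      show "Poly_Mapping.lookup v (Inr k) = Poly_Mapping.lookup (x_monomial \<alpha> + y_power j m) (Inr k)" for k
        using sum[of "Inr k"] by (cases "k = j") (auto simp: lookup_add lookup_single m_def)
    qed (simp add: \<alpha>_def lookup_add lookup_single)
    have unique: "\<not> nonunique e a (x_monomial \<alpha> + y_power j k)" if "k \<le> n" for k
    proof
      assume "nonunique e a (x_monomial \<alpha> + y_power j k)"
      then have "nonunique e a ((x_monomial \<alpha> + y_power j k) + (x_monomial (\<omega> - \<alpha>) + y_power j (n - k)))"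
        by (rule nonunique_add)
      moreover have "y_power j n = y_power j k + y_power j (n - k)" using that by (simp flip: single_add)
      ultimately have "nonunique e a (x_monomial \<omega> + y_power j n)"
        using x_monomial_le[OF le] by (simp add: ac_simps)
      then show False using \<omega> by (simp add: Hilb_def exponents_def)
    qed
    have "m = Suc n" using unique[of m] v vw(2) m by (auto simp: le_Suc_eq)
    then have "\<alpha> \<in> exponents j n" using unique[of n] v vw(2) by (simp add: exponents_def)
    then have "\<alpha> = \<omega>" using \<omega> le by (simp add: Hilb_def)
    then show ?thesis using vw(1) v \<open>m = Suc n\<close> by simp
  qed
  ultimately show "min_nonunique e a ?u" by (auto simp: min_nonunique_def)
qed

section \<open>Minimal monomials in the \<open>x\<close>-variables\<close>

text \<open>If \<omega> vanished at \<open>i\<close>, the functional dual to \<open>e i\<close>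
  would be 0 on the left-hand degree, but it is positive on \<open>e i\<close> and non-negative on
  the rest of the right-hand one.\<close>

lemma lookup_x_monomial_pos:
  assumes "deg (x_monomial \<omega>) = deg (var (Inl i) + w)"
  shows "\<omega> $ i \<noteq> 0"
proof
  assume zero: "\<omega> $ i = 0"
  obtain \<phi> :: "real ^ 'p \<Rightarrow> real" where \<phi>: "linear \<phi>" "0 < \<phi> (real_vec (e i))"
    "\<And>k. k \<noteq> i \<Longrightarrow> \<phi> (real_vec (e k)) = 0" "\<And>s. s \<in> S \<Longrightarrow> 0 \<le> \<phi> (real_vec s)"
    using functional[of i] by blast
  have "\<omega> $ k * \<phi> (real_vec (e k)) = 0" for k
    using zero \<phi>(3) by (cases "k = i") auto
  then have "(\<Sum>k\<in>UNIV. \<omega> $ k * \<phi> (real_vec (e k))) = 0" by (intro sum.neutral ballI)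
  then have "\<phi> (real_vec (deg (x_monomial \<omega>))) = 0"
    using \<phi>(1) by (simp add: real_vec_sum real_vec_scale linear_sum linear_scale)
  moreover have "\<phi> (real_vec (deg (var (Inl i) + w))) = \<phi> (real_vec (e i)) + \<phi> (real_vec (deg w))"
    using \<phi>(1) by (simp add: S_degree_add real_vec_add linear_add)
  ultimately show False using \<phi>(2) \<phi>(4)[OF deg_in_S[of w]] assms by simp
qed

text \<open>By minimality, every other monomial of the same degree is coprime to \<open>x_monomial \<omega>\<close>; by
  simpliciality it then contains no \<open>x\<close>-variable. Hence, once such a monomial is divisible
  by a \<open>pure_y\<close> monomial, exchanging the latter produces \<open>x_monomial \<omega>\<close> itself, and coprimality
  leaves no room for a cofactor.\<close>

lemma min_nonunique_x_monomial:
  assumes min: "min_nonunique e a (x_monomial \<omega>)"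
  obtains q where "pure_y q" "deg q = deg (x_monomial \<omega>)"
proof -
  let ?u = "x_monomial \<omega> :: ('t, 'r) mon"
  have coprime: "Poly_Mapping.lookup v x = 0 \<or> Poly_Mapping.lookup ?u x = 0"
    if v: "v \<noteq> ?u" "deg v = deg ?u" for v x
  proof (rule ccontr)
    assume "\<not> ?thesis"
    then have "1 \<le> Poly_Mapping.lookup v x" "1 \<le> Poly_Mapping.lookup ?u x" by simp_all
    then obtain v' u' where v': "v = var x + v'" and u': "?u = var x + u'"
      using pm_single_dvd by metis
    \<comment> \<open>Cancelling the common variable leaves two different monomials of equal degree,
      so \<open>u'\<close> is a nonunique proper divisor of \<open>?u\<close>.\<close>
    then have "deg v' = deg u'" "v' \<noteq> u'" using v unfolding u' v' by (simp_all add: S_degree_add)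
    then have "nonunique e a u'" by (auto simp: nonunique_def)
    then have "var x = 0" using min u' unfolding min_nonunique_def by (metis add.commute)
    then show False by simp
  qed
  have no_x: "Poly_Mapping.lookup v (Inl i) = 0" if v: "v \<noteq> ?u" "deg v = deg ?u" for v i
  proof (rule ccontr)
    assume nz: "Poly_Mapping.lookup v (Inl i) \<noteq> 0"
    then have "1 \<le> Poly_Mapping.lookup v (Inl i)" by simp
    then obtain w where "v = var (Inl i) + w" using pm_single_dvd by metis
    then have "\<omega> $ i \<noteq> 0" using v(2) lookup_x_monomial_pos[of \<omega> i w] by metis
    then show False using coprime[OF v, of "Inl i"] nz by simp
  qed
  obtain v where v: "v \<noteq> ?u" "deg v = deg ?u" using min by (auto simp: min_nonunique_def nonunique_def)
  then have nonunique: "nonunique e a v" by (auto simp: nonunique_def)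
  have \<omega>: "(\<chi> i. Poly_Mapping.lookup v (Inl i)) = 0" using no_x[OF v] by (simp add: vec_eq_iff)
  show thesis
  proof (cases rule: mon_classification[of v])
    case (divisible q w)
    obtain i w' where w': "deg q = deg (var (Inl i) + w')" using pure_y_exchange[OF divisible(1)] .
    let ?v' = "(var (Inl i) + w') + w"
    have deg: "deg ?v' = deg ?u" using w' v(2) unfolding divisible(2) by (simp add: S_degree_add)
    have "Poly_Mapping.lookup ?v' (Inl i) \<noteq> 0" by (simp add: lookup_add)
    then have v'u: "?v' = ?u" using no_x[OF _ deg] by metis
    have "w = 0"
    proof (rule poly_mapping_eqI)
      fix x
      have "Poly_Mapping.lookup w x \<le> Poly_Mapping.lookup v x"
        "Poly_Mapping.lookup w x \<le> Poly_Mapping.lookup ?u x"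
        unfolding v'u[symmetric] divisible(2) by (simp_all add: lookup_add)
      then show "Poly_Mapping.lookup w x = Poly_Mapping.lookup 0 x" using coprime[OF v, of x] by auto
    qed
    then show ?thesis using that divisible v(2) by simp
  next
    case none
    then show ?thesis using \<omega> nonunique nonunique_0 by simp
  next
    case (linear j)
    then have "v = var (Inr j)" using \<omega> by simp
    then show ?thesis using nonunique nonunique_var by blast
  next
    case (square j)
    then have "v = y_power j 2" using \<omega> by simp
    then show ?thesis using nonunique square_unique[OF square(1)] by blast
  qed
qed

section \<open>The degrees of the minimal monomials\<close>

text \<open>Follows the classification: a minimal monomial with a \<open>pure_y\<close> divisor
  equals it, and a minimal \<open>x_monomial\<close> shares its degree with a \<open>pure_y\<close>
  monomial. The other two classes are the Hilbert sets with \<open>n = 0\<close> and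
  \<open>n = 1\<close>.\<close>

lemma degrees_min_nonunique:
  "deg ` {u. min_nonunique e a u} =
     deg ` {q. pure_y q}
   \<union> {deg (x_monomial \<omega> + y_power j 1) | j \<omega>. \<omega> \<in> Hilb (T_set e a j)}
   \<union> {deg (x_monomial \<omega> + y_power j 2) | j \<omega>. 2 *s a j \<in> Ap S (range e) \<and> \<omega> \<in> Hilb (T'_set e a j)}"
  (is "_ = ?P \<union> ?T \<union> ?T'")
proof
  have "deg u \<in> ?P \<union> ?T \<union> ?T'" if min: "min_nonunique e a u" for u
  proof (cases rule: mon_classification[of u])
    case (divisible q w)
    then have "w = 0" using min pure_y_nonunique by (auto simp: min_nonunique_def)
    then show ?thesis using divisible by simp
  next
    case none
    then obtain q where q: "pure_y q" "deg q = deg u" using min min_nonunique_x_monomial by metis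
    then have "deg q \<in> ?P" by blast
    then show ?thesis using q(2) by simp
  next
    case (linear j)
    define \<omega> where "\<omega> = (\<chi> i. Poly_Mapping.lookup u (Inl i))"
    have u: "u = x_monomial \<omega> + y_power j 1" unfolding \<omega>_def by (rule linear)
    have "\<omega> \<in> Hilb (T_set e a j)"
      using min min_nonunique_iff_Hilb[of \<omega> j 0] by (simp add: u T_set_eq flip: One_nat_def)
    then have "deg u \<in> ?T" unfolding u mem_Collect_eq by (intro exI conjI) (rule refl)
    then show ?thesis by simp
  next
    case (square j)
    define \<omega> where "\<omega> = (\<chi> i. Poly_Mapping.lookup u (Inl i))"
    have u: "u = x_monomial \<omega> + y_power j 2" unfolding \<omega>_def by (rule square)
    have "\<omega> \<in> Hilb (T'_set e a j)"
      using min min_nonunique_iff_Hilb[of \<omega> j 1] by (simp add: u T'_set_eq Suc_1)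
    then have "deg u \<in> ?T'" unfolding u mem_Collect_eq using square(1) by (intro exI conjI) (rule refl)
    then show ?thesis by simp
  qed
  then show "deg ` {u. min_nonunique e a u} \<subseteq> ?P \<union> ?T \<union> ?T'" by (simp add: image_subset_iff)
  have P: "?P \<subseteq> deg ` {u. min_nonunique e a u}"
    by (intro image_mono) (simp add: Collect_mono pure_y_min_nonunique)
  have "min_nonunique e a (x_monomial \<omega> + y_power j 1)" if "\<omega> \<in> Hilb (T_set e a j)" for j \<omega>
    using that min_nonunique_iff_Hilb[of \<omega> j 0] by (simp add: T_set_eq flip: One_nat_def)
  then have T: "?T \<subseteq> deg ` {u. min_nonunique e a u}"
    by (intro subsetI, elim CollectE exE conjE, hypsubst, intro imageI CollectI)
  have "min_nonunique e a (x_monomial \<omega> + y_power j 2)" if "\<omega> \<in> Hilb (T'_set e a j)" for j \<omega>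
    using that min_nonunique_iff_Hilb[of \<omega> j 1] by (simp add: T'_set_eq Suc_1)
  then have T': "?T' \<subseteq> deg ` {u. min_nonunique e a u}"
    by (intro subsetI, elim CollectE exE conjE, hypsubst, intro imageI CollectI)
  from P T T' show "?P \<union> ?T \<union> ?T' \<subseteq> deg ` {u. min_nonunique e a u}" by simp
qed

lemma degrees_pure_y:
  "deg ` {q. pure_y q} =
     {x + y | x y. x \<in> range a \<and> y \<in> range a \<and> x \<noteq> y}
   \<union> {2 *s x | x. x \<in> range a \<and> 2 *s x \<in> (\<lambda>y. 2 *s y) ` range a - Ap S (range e)}
   \<union> {3 *s x | x. x \<in> range a \<and> 2 *s x \<in> (\<lambda>y. 2 *s y) ` range a \<inter> Ap S (range e)}"
  (is "_ = ?X \<union> ?Y \<union> ?Z")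
proof
  have "deg q \<in> ?X \<union> ?Y \<union> ?Z" if "pure_y q" for q
    using that
  proof cases
    case (mixed j k)
    then have "deg q \<in> ?X" unfolding mem_Collect_eq
      by (intro exI[of _ "a j"] exI[of _ "a k"]) (simp add: S_degree_add a_eq_iff)
    then show ?thesis by simp
  next
    case (square j)
    then have "deg q \<in> ?Y" unfolding mem_Collect_eq by (intro exI[of _ "a j"]) simp
    then show ?thesis by simp
  next
    case (cube j)
    then have "deg q \<in> ?Z" unfolding mem_Collect_eq by (intro exI[of _ "a j"]) simp
    then show ?thesis by simp
  qed
  then show "deg ` {q. pure_y q} \<subseteq> ?X \<union> ?Y \<union> ?Z" by (simp add: image_subset_iff)
  have X': "a j + a k \<in> deg ` {q. pure_y q}" if "a j \<noteq> a k" for j k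
  proof (rule image_eqI)
    show "y_power j 1 + y_power k 1 \<in> {q. pure_y q}" using that by (auto intro: pure_y.mixed)
  qed (simp add: S_degree_add)
  have X: "?X \<subseteq> deg ` {q. pure_y q}" by (clarify, rule X')
  have Y': "2 *s a j \<in> deg ` {q. pure_y q}" if "2 *s a j \<notin> Ap S (range e)" for j
  proof (rule image_eqI)
    show "y_power j 2 \<in> {q. pure_y q}" using that by (auto intro: pure_y.square)
  qed simp
  have Y: "?Y \<subseteq> deg ` {q. pure_y q}" by (clarify, rule Y')
  have Z': "3 *s a j \<in> deg ` {q. pure_y q}" if "2 *s a j \<in> Ap S (range e)" for j
  proof (rule image_eqI)
    show "y_power j 3 \<in> {q. pure_y q}" using that by (auto intro: pure_y.cube)
  qed simp
  have Z: "?Z \<subseteq> deg ` {q. pure_y q}" by (clarify, rule Z')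
  from X Y Z show "?X \<union> ?Y \<union> ?Z \<subseteq> deg ` {q. pure_y q}" by simp
qed

end

section \<open>From the hypotheses on \<open>S\<close> to the indexed generators\<close>

theorem lemma31:
  fixes S E A :: "(nat ^ 'p) set"
    and e :: "'t::finite \<Rightarrow> nat ^ 'p"
    and a :: "'r::finite \<Rightarrow> nat ^ 'p"
  assumes "affine_semigroup S" and "simplicial S" and "strong S"
    and "E = Mult S" and "bij_betw e UNIV E"
    and "A = msg S - E" and "bij_betw a UNIV A"
    and "card E = CARD('p)" and "A \<noteq> {}"
  shows "S_degree e a ` {u. indispensable TYPE('k::field) e a u} =
      {x + y | x y. x \<in> A \<and> y \<in> A \<and> x \<noteq> y}
    \<union> {2 *s x | x. x \<in> A \<and> 2 *s x \<in> (\<lambda>y. 2 *s y) ` A - Ap S E}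
    \<union> {3 *s x | x. x \<in> A \<and> 2 *s x \<in> (\<lambda>y. 2 *s y) ` A \<inter> Ap S E}
    \<union> {(\<Sum>i\<in>UNIV. \<omega> $ i *s e i) + a j | j \<omega>. \<omega> \<in> Hilb (T_set e a j)}
    \<union> {(\<Sum>i\<in>UNIV. \<omega> $ i *s e i) + 2 *s a j | j \<omega>.
         2 *s a j \<in> Ap S E \<and> \<omega> \<in> Hilb (T'_set e a j)}"
proof -
  have E: "E = range e" "inj e" and A: "A = range a" "inj a"
    using assms(5,7) by (auto simp: bij_betw_def)
  have msg: "msg S = irreducibles S" using assms(1) by (rule msg_eq_irreducibles)
  have sub: "range e \<subseteq> irreducibles S"
    using Mult_subset_irreducibles[OF assms(1)] assms(4) E(1) by simp
  have rangeA: "range a = irreducibles S - range e" using assms(6) msg E(1) A(1) by simp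
  interpret strong_simplicial S e a
  proof
    show "add_submonoid S" using assms(1) by (rule affine_semigroup_submonoid)
    \<comment> \<open>\<open>A\<close> is the complement of \<open>E\<close> in
      \<open>msg S\<close>, so no degree is shared by an \<open>x\<close>- and a
      \<open>y\<close>-variable.\<close>
    have ne: "e i \<noteq> a j" for i j using rangeA by blast
    show "inj (case_sum e a)"
    proof (rule injI)
      fix x y assume "case_sum e a x = case_sum e a y"
      then show "x = y"
        using E(2) A(2) ne ne[symmetric] by (cases x; cases y) (simp_all add: inj_eq)
    qed
    have "range (case_sum e a) = range e \<union> range a"
      by (simp add: UNIV_sum image_Un image_image)
    then show "range (case_sum e a) = irreducibles S"
      using sub by (simp add: rangeA Un_absorb1)
    have Mult: "Mult S = range e" using assms(4) E(1) by simp
    show "\<exists>i. diff_in (x + y) (e i) S" if "x \<in> S" "y \<in> S" "x \<noteq> 0" "y \<noteq> 0" "x \<noteq> y" for x y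
      using that assms(3) unfolding strong_def Mult by blast
    show "\<exists>\<phi> :: real ^ 'p \<Rightarrow> real. linear \<phi> \<and> 0 < \<phi> (real_vec (e i)) \<and>
      (\<forall>k. k \<noteq> i \<longrightarrow> \<phi> (real_vec (e k)) = 0) \<and> (\<forall>s\<in>S. 0 \<le> \<phi> (real_vec s))" for i
    proof -
      have mem: "e k \<in> Mult S" for k by (simp add: Mult)
      have "card (Mult S) = CARD('p)" using assms(4,8) by simp
      then show ?thesis
      proof (rule simplicial_Mult_functional[OF assms(1,2) _ mem[of i]])
        fix \<phi> :: "real ^ 'p \<Rightarrow> real"
        assume "linear \<phi>" "0 < \<phi> (real_vec (e i))"
          "\<And>y. y \<in> Mult S \<Longrightarrow> y \<noteq> e i \<Longrightarrow> \<phi> (real_vec y) = 0"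
          "\<And>s. s \<in> S \<Longrightarrow> 0 \<le> \<phi> (real_vec s)"
        \<comment> \<open>Injectivity of \<open>e\<close> turns \<open>k \<noteq> i\<close> into the
          distinctness of multiplicities required for \<phi> to vanish.\<close>
        then show ?thesis using mem E(2) by (intro exI[of _ \<phi>]) (auto simp: inj_eq)
      qed
    qed
  qed
  have "{u. indispensable TYPE('k) e a u} = {u. min_nonunique e a u}"
    using min_nonunique_imp_indispensable indispensable_imp_min_nonunique[OF deg_eq_0D] by blast
  then show ?thesis
    using degrees_min_nonunique degrees_pure_y unfolding E(1) A(1) by (simp add: S_degree_add)
qed

end
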